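(* Let $\phi^\sigma$ be a continuous flow on a compact Hausdorff space $X$, let $\Sigma\subset X\times X$ be closed with $\Delta\subset\Sigma$, and let $W\colon(X\times X)\setminus\Sigma\to\mathbb{Z}$ and $\pi\colon X\to\pi(X)\subset\mathbb{R}^2$ satisfy Axioms (A1)-(A5) listed in the context. Let $u\in X$. Then $\pi\colon\omega(u)\to\pi(\omega(u))$ is a homeomorphism onto its image. Hence $\pi\circ\phi^\sigma$ induces a flow on $\pi(\omega(u))$, namely $x\mapsto\pi\bigl(\phi^\sigma\bigl((\pi|_{\omega(u)})^{-1}(x)\bigr)\bigr)$ is a continuous flow on $\pi(\omega(u))$.
   Context: A continuous flow on $X$ is a continuous map $\mathbb{R}\times X\to X$, $(\sigma,u)\mapsto\phi^\sigma(u)$, with $\phi^0=\mathrm{id}$ and $\phi^{\sigma+\sigma'}=\phi^\sigma\circ\phi^{\sigma'}$. $\Delta=\{(u^1,u^2)\in X\times X:u^1=u^2\}$ is the diagonal. The axioms are: (A1) $W\colon(X\times X)\setminus\Sigma\to\mathbb{Z}$ is continuous and symmetric, i.e. $W(u^1,u^2)=W(u^2,u^1)$; (A2) $\pi\colon X\to\pi(X)\subset\mathbb{R}^2$ is a continuous map onto its (compact) image; (A3) $\{(u^1,u^2)\in X\times X:\pi(u^1)=\pi(u^2)\}\subset\Sigma$; (A4) for every $(u^1,u^2)\in\Sigma\setminus\Delta$ there is $\varepsilon_0>0$, depending on $(u^1,u^2)$, such that $(\phi^\sigma(u^1),\phi^\sigma(u^2))\notin\Sigma$ for all $\sigma\in(-\varepsilon_0,\varepsilon_0)\setminus\{0\}$;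 (A5) for every $(u^1,u^2)\in\Sigma\setminus\Delta$ there is $\varepsilon_0>0$, depending on $(u^1,u^2)$ (and small enough that the values below are defined, by (A4)), such that $W(\phi^\sigma(u^1),\phi^\sigma(u^2))>W(\phi^{\sigma'}(u^1),\phi^{\sigma'}(u^2))$ for all $\sigma\in(-\varepsilon_0,0)$ and all $\sigma'\in(0,\varepsilon_0)$. $\omega(u)=\{w\in X:\phi^{\sigma_n}(u)\to w\text{ for some }\sigma_n\to\infty\}$ and $\alpha(u)=\{w\in X:\phi^{\sigma_n}(u)\to w\text{ for some }\sigma_n\to-\infty\}$; these are taken to be non-empty, compact, connected, invariant sets. *)

theory Defs
  imports "HOL-Analysis.Analysis"
begin

text \<open>
  The space \<open>X\<close> is the universe of a Hausdorff type with compact \<open>UNIV\<close>. Flows are nevertheless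
  defined relative to a set \<open>S\<close>, since the induced flow lives on a subset of the plane; the values
  of \<open>\<phi> \<sigma>\<close> outside \<open>S\<close> are irrelevant.
\<close>

definition continuous_flow_on :: "'a::topological_space set \<Rightarrow> (real \<Rightarrow> 'a \<Rightarrow> 'a) \<Rightarrow> bool" where
  "continuous_flow_on S \<phi> \<longleftrightarrow>
     (\<forall>\<sigma>. \<forall>x\<in>S. \<phi> \<sigma> x \<in> S) \<and>
     continuous_on (UNIV \<times> S) (\<lambda>(\<sigma>, x). \<phi> \<sigma> x) \<and>
     (\<forall>x\<in>S. \<phi> 0 x = x) \<and>
     (\<forall>\<sigma> \<sigma>'. \<forall>x\<in>S. \<phi> (\<sigma> + \<sigma>') x = \<phi> \<sigma> (\<phi> \<sigma>' x))"

definition omega_limit :: "(real \<Rightarrow> 'a \<Rightarrow> 'a) \<Rightarrow> 'a::topological_space \<Rightarrow> 'a set" where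
  "omega_limit \<phi> u =
     {w. \<exists>s::nat \<Rightarrow> real. filterlim s at_top sequentially \<and> (\<lambda>n. \<phi> (s n) u) \<longlonglongrightarrow> w}"

definition diagonal :: "('a \<times> 'a) set" where
  "diagonal = {(u1, u2). u1 = u2}"

text \<open>
  In the axioms \<open>W\<close> is a total function of which only the values off \<open>Sig\<close> are used. Symmetry of a
  function defined off \<open>Sig\<close> includes that its domain is symmetric. The type \<open>int\<close> carries the
  discrete topology.
\<close>

definition axiom_A1 :: "('a::topological_space \<times> 'a) set \<Rightarrow> ('a \<times> 'a \<Rightarrow> int) \<Rightarrow> bool" where
  "axiom_A1 Sig W \<longleftrightarrow>
     continuous_on (UNIV - Sig) W \<and>
     (\<forall>u1 u2. (u1, u2) \<notin> Sig \<longrightarrow> (u2, u1) \<notin> Sig \<and> W (u1, u2) = W (u2, u1))"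

definition axiom_A2 :: "('a::topological_space \<Rightarrow> real ^ 2) \<Rightarrow> bool" where
  "axiom_A2 \<pi> \<longleftrightarrow> continuous_on UNIV \<pi>"

definition axiom_A3 :: "('a \<times> 'a) set \<Rightarrow> ('a \<Rightarrow> real ^ 2) \<Rightarrow> bool" where
  "axiom_A3 Sig \<pi> \<longleftrightarrow> {(u1, u2). \<pi> u1 = \<pi> u2} \<subseteq> Sig"

definition axiom_A4 :: "(real \<Rightarrow> 'a \<Rightarrow> 'a) \<Rightarrow> ('a \<times> 'a) set \<Rightarrow> bool" where
  "axiom_A4 \<phi> Sig \<longleftrightarrow>
     (\<forall>(u1, u2) \<in> Sig - diagonal. \<exists>\<epsilon>>0. \<forall>\<sigma> \<in> {-\<epsilon><..<\<epsilon>} - {0}. (\<phi> \<sigma> u1, \<phi> \<sigma> u2) \<notin> Sig)"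

text \<open>
  The first conjunct under the existential makes \<open>\<epsilon>\<close> small enough for the compared values to be
  values of \<open>W\<close> off \<open>Sig\<close>; such an \<open>\<epsilon>\<close> exists by the previous axiom.
\<close>

definition axiom_A5 ::
  "(real \<Rightarrow> 'a \<Rightarrow> 'a) \<Rightarrow> ('a \<times> 'a) set \<Rightarrow> ('a \<times> 'a \<Rightarrow> int) \<Rightarrow> bool" where
  "axiom_A5 \<phi> Sig W \<longleftrightarrow>
     (\<forall>(u1, u2) \<in> Sig - diagonal. \<exists>\<epsilon>>0.
        (\<forall>\<sigma> \<in> {-\<epsilon><..<\<epsilon>} - {0}. (\<phi> \<sigma> u1, \<phi> \<sigma> u2) \<notin> Sig) \<and>
        (\<forall>\<sigma> \<in> {-\<epsilon><..<0}. \<forall>\<sigma>' \<in> {0<..<\<epsilon>}.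
           W (\<phi> \<sigma> u1, \<phi> \<sigma> u2) > W (\<phi> \<sigma>' u1, \<phi> \<sigma>' u2)))"

end

(*
A pair of points of X that is not yet on the diagonal carries the integer W, which is nonincreasing
along the product flow and drops strictly at every crossing of Sig. Let Om be the topological
omega-limit set (the intersection of the closures of the forward tails of the orbit of u); it
contains the sequential one and is compact, so it suffices that Sig meets Om x Om only in the
diagonal, because then pi is injective on Om by (A3).

If Om is minimal, a pigeonhole argument on return times shows this. Otherwise W is equal to one
constant a on all pairs with one point in a minimal subset of Om, because u keeps visiting both
points of any pair in Om and minimal sets are invariant. Suppose some pair in Om x Om has W < a. Its
omega-limit set under the product flow has W < a off the diagonal, and must meet the diagonal, but
only in equilibria, since near a moving point a small time shift of one coordinate produces the value
a. A limit of entries into ever longer stays near these equilibria gives a pair (z, z') with W < a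
such that z stays near them for all later times. As u passes near z' and later far from the
equilibria, comparing it with z yields the value a after a value below a, a contradiction. Reversing
time and the sign of W excludes W > a. So W is constant on Om x Om off Sig, and no drop can occur.
*)

theory Submission
  imports Defs
begin

section \<open>Limit sets\<close>

text \<open>By the finite intersection property: since the sets are nested, finitely many of them
  all contain the one of largest index.\<close>

lemma compact_decreasing_Inter_nonempty:
  fixes F :: "real \<Rightarrow> 'b::topological_space set"
  assumes K: "compact K" and F: "\<And>t. closed (F t)" "\<And>t. K \<inter> F t \<noteq> {}"
    and anti: "\<And>s t. s \<le> t \<Longrightarrow> F t \<subseteq> F s"
  shows "K \<inter> (\<Inter>t. F t) \<noteq> {}"
proof (rule compact_imp_fip_image[OF K])
  fix I :: "real set"
  assume I: "finite I"
  \<comment> \<open>Inserting 0 gives the maximum a value when \<open>I\<close> is empty.\<close>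
  have "F (Max (insert 0 I)) \<subseteq> F t" if "t \<in> I" for t
    using I that by (intro anti) auto
  then have "K \<inter> F (Max (insert 0 I)) \<subseteq> K \<inter> (\<Inter>t\<in>I. F t)"
    by blast
  then show "K \<inter> (\<Inter>t\<in>I. F t) \<noteq> {}"
    using F(2) by blast
qed (use F in auto)

lemma compact_t2_separation:
  fixes A B :: "'b::t2_space set"
  assumes "compact A" "compact B" "A \<inter> B = {}"
  obtains U V where "open U" "open V" "A \<subseteq> U" "B \<subseteq> V" "U \<inter> V = {}"
proof -
  have "Hausdorff_space (euclidean :: 'b topology)"
    by (metis Hausdorff_space_def disjnt_def open_openin separation_t2)
  then show thesis
    using Hausdorff_space_compact_separation[of euclidean A B] assms that
    by (auto simp: disjnt_def)
qed

text \<open>Intersecting closures of tails, rather than collecting limits of sequences, lets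
  compactness produce limit points without first countability. Arbitrary curves are allowed so that
  orbits of the product flow are covered as well.\<close>

definition limit_set :: "(real \<Rightarrow> 'b::topological_space) \<Rightarrow> 'b set" where
  "limit_set f = (\<Inter>T. closure (f ` {T..}))"

lemma closed_limit_set: "closed (limit_set f)"
  unfolding limit_set_def by auto

lemma limit_setD:
  assumes "x \<in> limit_set f" "open N" "x \<in> N"
  obtains s where "s \<ge> T" "f s \<in> N"
proof -
  have "x \<in> closure (f ` {T..})"
    using assms(1) by (auto simp: limit_set_def)
  then have "N \<inter> f ` {T..} \<noteq> {}"
    using assms(2,3) open_Int_closure_eq_empty by blast
  then show thesis
    using that by auto
qed

lemma limit_set_subset:
  assumes "closed C" "\<And>s. s \<ge> T \<Longrightarrow> f s \<in> C"
  shows "limit_set f \<subseteq> C"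
proof -
  have "closure (f ` {T..}) \<subseteq> C"
    by (rule closure_minimal) (use assms in auto)
  then show ?thesis
    by (auto simp: limit_set_def)
qed

lemma limit_set_Int_nonempty:
  assumes "compact K" "\<And>T. \<exists>s\<ge>T. f s \<in> K"
  shows "K \<inter> limit_set f \<noteq> {}"
proof -
  have "K \<inter> (\<Inter>T. closure (f ` {T..})) \<noteq> {}"
  proof (rule compact_decreasing_Inter_nonempty[OF assms(1)])
    show "K \<inter> closure (f ` {T..}) \<noteq> {}" for T
    proof -
      obtain s where "s \<ge> T" "f s \<in> K"
        using assms(2) by blast
      then have "f s \<in> K \<inter> closure (f ` {T..})"
        by (simp add: closure_subset[THEN subsetD])
      then show ?thesis by blast
    qed
    show "closure (f ` {t..}) \<subseteq> closure (f ` {s..})" if "s \<le> t" for s t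
      by (rule closure_mono) (use that in auto)
  qed auto
  then show ?thesis
    by (simp add: limit_set_def)
qed

text \<open>Disjoint neighbourhoods of the two compact pieces of a separation would eventually
  contain the curve, since otherwise a limit point would lie outside both. A tail is connected, yet
  it visits both.\<close>

lemma connected_limit_set:
  fixes f :: "real \<Rightarrow> 'b::t2_space"
  assumes com: "compact (UNIV :: 'b set)" and f: "continuous_on UNIV f"
  shows "connected (limit_set f)"
proof (rule ccontr)
  have comp: "compact C" if "closed C" for C :: "'b set"
    using closed_Int_compact[OF that com] by simp
  assume "\<not> connected (limit_set f)"
  then obtain A B where AB: "closed A" "closed B" "limit_set f \<subseteq> A \<union> B"
    "A \<inter> B \<inter> limit_set f = {}" "A \<inter> limit_set f \<noteq> {}" "B \<inter> limit_set f \<noteq> {}"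
    by (auto simp: connected_closed)
  have "compact (A \<inter> limit_set f)" "compact (B \<inter> limit_set f)"
    using AB closed_limit_set by (auto intro!: comp)
  then obtain U V where UV: "open U" "open V" "A \<inter> limit_set f \<subseteq> U" "B \<inter> limit_set f \<subseteq> V"
      "U \<inter> V = {}"
    by (rule compact_t2_separation) (use AB in auto)
  have "\<exists>T. \<forall>s\<ge>T. f s \<in> U \<union> V"
  proof (rule ccontr)
    assume *: "\<not> ?thesis"
    have "- (U \<union> V) \<inter> limit_set f \<noteq> {}"
    proof (rule limit_set_Int_nonempty)
      show "compact (- (U \<union> V))"
        using UV by (intro comp) auto
    qed (use * in blast)
    then show False
      using UV AB by blast
  qed
  then obtain T where T: "\<And>s. s \<ge> T \<Longrightarrow> f s \<in> U \<union> V"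
    by blast
  have "connected (f ` {T..})"
    by (intro connected_continuous_image continuous_on_subset[OF f]) auto
  then have "U \<inter> f ` {T..} = {} \<or> V \<inter> f ` {T..} = {}"
    using UV T by (intro connectedD) auto
  moreover obtain a b where ab: "a \<in> A \<inter> limit_set f" "b \<in> B \<inter> limit_set f"
    using AB by blast
  moreover obtain s where "s \<ge> T" "f s \<in> U"
    using limit_setD[of a f U T] ab UV by blast
  moreover obtain t where "t \<ge> T" "f t \<in> V"
    using limit_setD[of b f V T] ab UV by blast
  ultimately show False
    by auto
qed

section \<open>Flows on compact Hausdorff spaces and their squares\<close>

definition pair_flow :: "(real \<Rightarrow> 'a \<Rightarrow> 'a) \<Rightarrow> real \<Rightarrow> 'a \<times> 'a \<Rightarrow> 'a \<times> 'a" where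
  "pair_flow \<phi> s Q = (\<phi> s (fst Q), \<phi> s (snd Q))"

lemma pair_flow_simps [simp]:
  "pair_flow \<phi> s (x, y) = (\<phi> s x, \<phi> s y)"
  "fst (pair_flow \<phi> s Q) = \<phi> s (fst Q)"
  "snd (pair_flow \<phi> s Q) = \<phi> s (snd Q)"
  by (simp_all add: pair_flow_def)

locale compact_flow =
  fixes \<phi> :: "real \<Rightarrow> 'a::t2_space \<Rightarrow> 'a"
  assumes compact_UNIV: "compact (UNIV :: 'a set)"
    and continuous_flow: "continuous_on UNIV (\<lambda>p. \<phi> (fst p) (snd p))"
    and flow_zero [simp]: "\<phi> 0 x = x"
    and flow_add: "\<phi> (s + t) x = \<phi> s (\<phi> t x)"
begin

lemma continuous_on_flow [continuous_intros]:
  fixes f :: "'c::topological_space \<Rightarrow> real"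
  assumes "continuous_on S f" "continuous_on S g"
  shows "continuous_on S (\<lambda>x. \<phi> (f x) (g x))"
  using continuous_on_compose2[OF continuous_flow continuous_on_Pair[OF assms]] by simp

lemma flow_inverse [simp]: "\<phi> (- s) (\<phi> s x) = x" "\<phi> s (\<phi> (- s) x) = x"
  using flow_add[of "-s" s x] flow_add[of s "-s" x] by simp_all

lemma flow_eq_iff [simp]: "\<phi> s x = \<phi> s y \<longleftrightarrow> x = y"
  by (metis flow_inverse(1))

lemma closed_compact: "closed C \<Longrightarrow> compact (C :: 'a set)"
  using closed_Int_compact[OF _ compact_UNIV] by simp

lemma compact_flow_pair: "compact_flow (pair_flow \<phi>)"
proof
  show "compact (UNIV :: ('a \<times> 'a) set)"
    using compact_Times[OF compact_UNIV compact_UNIV] by simp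
  show "continuous_on UNIV (\<lambda>p. pair_flow \<phi> (fst p) (snd p))"
    unfolding pair_flow_def by (intro continuous_intros)
qed (simp_all add: pair_flow_def flow_add)

lemma compact_flow_reverse: "compact_flow (\<lambda>s. \<phi> (- s))"
proof
  show "continuous_on UNIV (\<lambda>p. \<phi> (- fst p) (snd p))"
    by (intro continuous_intros)
  show "\<phi> (- (s + t)) x = \<phi> (- s) (\<phi> (- t) x)" for s t x
    using flow_add[of "-s" "-t" x] by simp
qed (simp_all add: compact_UNIV)

definition invariant :: "'a set \<Rightarrow> bool" where
  "invariant S \<longleftrightarrow> (\<forall>s. \<forall>x\<in>S. \<phi> s x \<in> S)"

lemma invariantD: "invariant S \<Longrightarrow> x \<in> S \<Longrightarrow> \<phi> s x \<in> S"
  by (auto simp: invariant_def)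

lemma invariant_iff: "invariant S \<Longrightarrow> \<phi> s x \<in> S \<longleftrightarrow> x \<in> S"
  by (metis flow_inverse(1) invariantD)

lemma invariant_limit_set: "invariant (limit_set (\<lambda>s. \<phi> s x))"
  unfolding invariant_def limit_set_def
proof (intro allI ballI INT_I)
  fix s y T assume y: "y \<in> (\<Inter>T. closure ((\<lambda>s. \<phi> s x) ` {T..}))"
  have "\<phi> s ` closure ((\<lambda>s. \<phi> s x) ` {T - s..}) \<subseteq> closure ((\<lambda>s. \<phi> s x) ` {T..})"
  proof (rule image_closure_subset)
    show "continuous_on (closure ((\<lambda>s. \<phi> s x) ` {T - s..})) (\<phi> s)"
      by (intro continuous_intros)
    show "\<phi> s ` (\<lambda>s. \<phi> s x) ` {T - s..} \<subseteq> closure ((\<lambda>s. \<phi> s x) ` {T..})"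
      by (auto simp flip: flow_add intro!: closure_subset[THEN subsetD])
  qed auto
  then show "\<phi> s y \<in> closure ((\<lambda>s. \<phi> s x) ` {T..})"
    using y by blast
qed

section \<open>Orbit closures and minimal sets\<close>

definition orbit_closure :: "'a \<Rightarrow> 'a set" where
  "orbit_closure x = closure (range (\<lambda>s. \<phi> s x))"

lemma orbit_closure_self [simp]: "x \<in> orbit_closure x"
  unfolding orbit_closure_def by (rule closure_subset[THEN subsetD]) (metis flow_zero rangeI)

lemma invariant_closure:
  assumes "invariant S"
  shows "invariant (closure S)"
  unfolding invariant_def
proof (intro allI ballI)
  fix s y assume y: "y \<in> closure S"
  have "\<phi> s ` closure S \<subseteq> closure S"
  proof (rule image_closure_subset)
    show "continuous_on (closure S) (\<phi> s)"
      by (intro continuous_intros)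
    show "\<phi> s ` S \<subseteq> closure S"
      using assms closure_subset by (auto simp: invariant_def)
  qed auto
  then show "\<phi> s y \<in> closure S"
    using y by blast
qed

lemma invariant_orbit_closure: "invariant (orbit_closure x)"
  unfolding orbit_closure_def
  by (rule invariant_closure) (auto simp: invariant_def simp flip: flow_add)

lemma closed_orbit_closure: "closed (orbit_closure x)"
  by (simp add: orbit_closure_def)

lemma orbit_closure_subset: "closed C \<Longrightarrow> invariant C \<Longrightarrow> x \<in> C \<Longrightarrow> orbit_closure x \<subseteq> C"
  unfolding orbit_closure_def by (rule closure_minimal) (auto dest: invariantD)

lemma connected_orbit_closure: "connected (orbit_closure x)"
  unfolding orbit_closure_def
  by (intro connected_imp_connected_closure connected_continuous_image continuous_intros) simp

text \<open>Minimality in the usual sense, with the absence of smaller closed invariant sets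
  expressed as density of every orbit.\<close>

definition minimal :: "'a set \<Rightarrow> bool" where
  "minimal M \<longleftrightarrow> closed M \<and> invariant M \<and> M \<noteq> {} \<and> (\<forall>y\<in>M. orbit_closure y = M)"

text \<open>Zorn's lemma is applied to the open invariant sets that do not cover \<open>C\<close>;
  what a maximal one leaves of \<open>C\<close> is minimal. Compactness of \<open>C\<close> prevents
  the union of a chain from covering it.\<close>

lemma minimal_exists:
  assumes C: "closed C" "invariant C" "C \<noteq> {}"
  obtains M where "minimal M" "M \<subseteq> C"
proof -
  define \<A> where "\<A> = {U. open U \<and> invariant U \<and> \<not> C \<subseteq> U}"
  have "\<exists>U\<in>\<A>. \<forall>X\<in>\<A>. U \<subseteq> X \<longrightarrow> X = U"
  proof (rule subset_Zorn_nonempty)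
    have "{} \<in> \<A>" using C by (auto simp: \<A>_def invariant_def)
    then show "\<A> \<noteq> {}" by blast
    fix \<C> assume \<C>: "\<C> \<noteq> {}" "subset.chain \<A> \<C>"
    then have sub: "\<C> \<subseteq> \<A>" by (simp add: subset.chain_def)
    have "\<not> C \<subseteq> \<Union>\<C>"
    proof
      assume "C \<subseteq> \<Union>\<C>"
      then obtain \<D> where \<D>: "\<D> \<subseteq> \<C>" "finite \<D>" "C \<subseteq> \<Union>\<D>"
        using closed_compact[OF C(1)] sub by (elim compactE) (auto simp: \<A>_def)
      have "\<D> \<noteq> {}" using \<D> C by auto
      \<comment> \<open>A nonempty finite subfamily of a chain has its union as largest
        member.\<close>
      have "\<Union>\<D> \<in> \<C>"
      proof -
        have "subset.chain \<A> \<D>"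
          using \<C>(2) \<D>(1) unfolding subset.chain_def by blast
        then show ?thesis
          using Union_in_chain[of \<D> \<A>] \<D> \<open>\<D> \<noteq> {}\<close> by blast
      qed
      then show False
        using sub \<D> by (auto simp: \<A>_def)
    qed
    then show "\<Union>\<C> \<in> \<A>"
      using sub by (fastforce simp: \<A>_def invariant_def)
  qed
  then obtain U where U: "U \<in> \<A>" and max: "\<And>X. X \<in> \<A> \<Longrightarrow> U \<subseteq> X \<Longrightarrow> X = U"
    by blast
  have cl: "closed (C - U)" and inv: "invariant (C - U)"
    using U C by (auto simp: \<A>_def invariant_iff invariant_def dest: invariantD)
  have "C - U \<subseteq> orbit_closure y" if y: "y \<in> C - U" for y
  proof -
    have "orbit_closure y \<subseteq> C - U"
      using orbit_closure_subset[OF cl inv y] .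
    \<comment> \<open>The complement of the orbit closure is a competitor containing
      \<open>U\<close>, so maximality makes the two equal.\<close>
    moreover have "- orbit_closure y \<in> \<A>"
      using y orbit_closure_self[of y] closed_orbit_closure[of y] invariant_orbit_closure[of y]
      by (auto simp: \<A>_def invariant_iff invariant_def)
    ultimately have "- orbit_closure y = U"
      by (intro max) auto
    then show ?thesis by blast
  qed
  then have "minimal (C - U)"
    using orbit_closure_subset[OF cl inv] cl inv U by (auto simp: minimal_def \<A>_def)
  then show thesis
    using that by blast
qed

lemma minimal_disjoint:
  assumes "minimal M" "minimal M'" "M \<inter> M' \<noteq> {}"
  shows "M = M'"
  using assms by (auto simp: minimal_def)

section \<open>Equilibria and periodic orbits\<close>

definition equilibrium :: "'a \<Rightarrow> bool" where
  "equilibrium x \<longleftrightarrow> (\<forall>s. \<phi> s x = x)"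

lemma minimal_equilibrium:
  assumes "equilibrium x"
  shows "minimal {x}"
proof -
  have "orbit_closure x = {x}"
    using assms by (simp add: orbit_closure_def equilibrium_def)
  then show ?thesis
    using assms by (simp add: minimal_def invariant_def equilibrium_def)
qed

lemma flow_nat_multiple:
  assumes "\<phi> c p = p"
  shows "\<phi> (real n * c) p = p"
proof (induction n)
  case (Suc n)
  have "\<phi> (real (Suc n) * c) p = \<phi> c (\<phi> (real n * c) p)"
    by (simp add: algebra_simps flip: flow_add)
  then show ?case
    using Suc assms by simp
qed simp

text \<open>Every time is an integer multiple of a time shorter than \<open>\<delta>\<close>, which
  is a period.\<close>

lemma equilibrium_if_small_periods:
  assumes "\<delta> > 0" and p: "\<And>c. \<bar>c\<bar> < \<delta> \<Longrightarrow> \<phi> c p = p"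
  shows "equilibrium p"
  unfolding equilibrium_def
proof
  fix s
  obtain n :: nat where n: "\<bar>s\<bar> / \<delta> < real n"
    using reals_Archimedean2 by blast
  moreover have "\<bar>s\<bar> / \<delta> \<ge> 0"
    using assms(1) by simp
  ultimately have "n > 0"
    by (cases n) auto
  then have "\<bar>s / real n\<bar> < \<delta>"
    using n assms(1) by (simp add: field_simps)
  then show "\<phi> s p = p"
    using flow_nat_multiple[of "s / real n" p n] p \<open>n > 0\<close> by simp
qed

text \<open>Reduction modulo the period shows the orbit to be the image of a compact time interval,
  hence closed.\<close>

lemma orbit_closure_periodic:
  assumes c: "c \<noteq> 0" "\<phi> c p = p"
  shows "orbit_closure p = range (\<lambda>s. \<phi> s p)"
proof -
  define T where "T = \<bar>c\<bar>"
  have T: "T > 0" "\<phi> T p = p"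
    using c flow_inverse(1)[of c p] by (auto simp: T_def abs_if)
  have "\<phi> s p \<in> (\<lambda>s. \<phi> s p) ` {0..T}" for s
  proof -
    define k where "k = \<lfloor>s / T\<rfloor>"
    have k: "of_int k \<le> s / T" "s / T < of_int k + 1"
      unfolding k_def by linarith+
    have *: "\<phi> (of_int k * T) p = p"
    proof (cases "k \<ge> 0")
      case True
      then show ?thesis
        using flow_nat_multiple[OF T(2), of "nat k"] by simp
    next
      case False
      then have "\<phi> (- (of_int k * T)) p = p"
        using flow_nat_multiple[OF T(2), of "nat (- k)"] by simp
      then show ?thesis
        using flow_inverse(2)[of "of_int k * T" p] by simp
    qed
    have "\<phi> s p = \<phi> (s - of_int k * T) (\<phi> (of_int k * T) p)"
      by (simp flip: flow_add)
    moreover have "s - of_int k * T \<in> {0..T}"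
      using k T(1) by (auto simp: field_simps)
    ultimately show ?thesis
      using * by auto
  qed
  then have "range (\<lambda>s. \<phi> s p) = (\<lambda>s. \<phi> s p) ` {0..T}"
    by auto
  moreover have "compact ((\<lambda>s. \<phi> s p) ` {0..T})"
    by (intro compact_continuous_image continuous_intros) auto
  ultimately show ?thesis
    by (simp add: orbit_closure_def compact_imp_closed)
qed

end

section \<open>Discrete Lyapunov functions\<close>

text \<open>The purely dynamical part of the axioms: \<open>W_drop\<close> combines (A4) and (A5) in
  terms of the product flow, and the projection is left to the end.\<close>

locale discrete_lyapunov_flow = compact_flow \<phi>
  for \<phi> :: "real \<Rightarrow> 'a::t2_space \<Rightarrow> 'a" +
  fixes Sig :: "('a \<times> 'a) set" and W :: "'a \<times> 'a \<Rightarrow> int"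
  assumes closed_Sig: "closed Sig"
    and diagonal_in_Sig: "(x, x) \<in> Sig"
    and continuous_W: "continuous_on (- Sig) W"
    and W_sym: "(x, y) \<notin> Sig \<Longrightarrow> (y, x) \<notin> Sig \<and> W (x, y) = W (y, x)"
    and W_drop: "Q \<in> Sig \<Longrightarrow> fst Q \<noteq> snd Q \<Longrightarrow>
      \<exists>e>0. (\<forall>s. s \<noteq> 0 \<longrightarrow> \<bar>s\<bar> < e \<longrightarrow> pair_flow \<phi> s Q \<notin> Sig) \<and>
        (\<forall>s t. - e < s \<longrightarrow> s < 0 \<longrightarrow> 0 < t \<longrightarrow> t < e \<longrightarrow>
          W (pair_flow \<phi> t Q) < W (pair_flow \<phi> s Q))"
begin

abbreviation "\<Phi> \<equiv> pair_flow \<phi>"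

sublocale pair: compact_flow \<Phi>
  by (rule compact_flow_pair)

text \<open>\<open>W\<close> is meaningful only off \<open>Sig\<close>, so every statement about a
  value carries that condition along. These sets turn out to be open, whence values persist under
  small perturbations.\<close>

definition level :: "int \<Rightarrow> ('a \<times> 'a) set" where
  "level k = {Q. Q \<notin> Sig \<and> W Q = k}"

lemma level_self: "Q \<notin> Sig \<Longrightarrow> Q \<in> level (W Q)"
  by (simp add: level_def)

lemma level_unique: "Q \<in> level k \<Longrightarrow> Q \<in> level l \<Longrightarrow> k = l"
  by (simp add: level_def)

lemma level_not_diagonal: "Q \<in> level k \<Longrightarrow> fst Q \<noteq> snd Q"
  using diagonal_in_Sig by (cases Q) (auto simp: level_def)

lemma level_commute: "(x, y) \<in> level k \<longleftrightarrow> (y, x) \<in> level k"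
  using W_sym by (auto simp: level_def)

lemma open_level: "open (level k)"
proof -
  have "level k = W -` {k} \<inter> (- Sig)"
    by (auto simp: level_def)
  moreover have "open (W -` {k} \<inter> (- Sig))"
    using continuous_W closed_Sig open_discrete
    by (subst (asm) continuous_on_open_vimage) (auto simp: open_Compl)
  ultimately show ?thesis
    by simp
qed

text \<open>The level \<open>k\<close> and the union of all other levels are disjoint open sets
  covering \<open>S\<close>.\<close>

lemma connected_subset_level:
  assumes "connected S" "S \<inter> Sig = {}" "Q \<in> S" "Q \<in> level k"
  shows "S \<subseteq> level k"
proof -
  have "level k \<inter> S = {} \<or> (\<Union>l\<in>-{k}. level l) \<inter> S = {}"
  proof (rule connectedD[OF assms(1)])
    show "open (level k)" "open (\<Union>l\<in>-{k}. level l)"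
      by (auto intro: open_level)
  qed (use assms in \<open>auto simp: level_def\<close>)
  then show ?thesis
    using assms unfolding level_def by blast
qed

section \<open>Monotonicity of \<open>W\<close> along orbits of pairs\<close>

lemma curve_in_level:
  assumes f: "continuous_on I f" "connected I" "\<And>t. t \<in> I \<Longrightarrow> f t \<notin> Sig"
    and "s \<in> I" "f s \<in> level k" "t \<in> I"
  shows "f t \<in> level k"
proof -
  have "f ` I \<subseteq> level k"
    using assms by (intro connected_subset_level connected_continuous_image) auto
  then show ?thesis
    using assms by blast
qed

text \<open>Off \<open>Sig\<close> the value is locally constant. At a crossing, times on one side
  give equal values by connectedness, and times on opposite sides are compared by
  \<open>W_drop\<close>.\<close>

lemma W_locally_nonincreasing:
  assumes Q: "fst Q \<noteq> snd Q"
  shows "\<exists>d>0. \<forall>s t. s \<le> t \<longrightarrow> \<bar>s\<bar> < d \<longrightarrow> \<bar>t\<bar> < d \<longrightarrow> \<Phi> s Q \<notin> Sig \<longrightarrow> \<Phi> t Q \<notin> Sig \<longrightarrow>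
    W (\<Phi> t Q) \<le> W (\<Phi> s Q)"
proof (cases "Q \<in> Sig")
  case False
  have "open ((\<lambda>s. \<Phi> s Q) -` level (W Q))"
    by (intro open_vimage open_level continuous_intros)
  moreover have "0 \<in> (\<lambda>s. \<Phi> s Q) -` level (W Q)"
    using False by (simp add: level_self)
  ultimately obtain d where "d > 0" "ball 0 d \<subseteq> (\<lambda>s. \<Phi> s Q) -` level (W Q)"
    using openE by blast
  then have "\<forall>s. \<bar>s\<bar> < d \<longrightarrow> \<Phi> s Q \<in> level (W Q)"
    by (auto simp: subset_iff)
  then show ?thesis
    using \<open>d > 0\<close> by (intro exI[of _ d]) (auto simp: level_def)
next
  case True
  then obtain e where e: "e > 0" "\<And>s. s \<noteq> 0 \<Longrightarrow> \<bar>s\<bar> < e \<Longrightarrow> \<Phi> s Q \<notin> Sig"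
    "\<And>s t. - e < s \<Longrightarrow> s < 0 \<Longrightarrow> 0 < t \<Longrightarrow> t < e \<Longrightarrow> W (\<Phi> t Q) < W (\<Phi> s Q)"
    using W_drop[OF True Q] by blast
  have "W (\<Phi> t Q) \<le> W (\<Phi> s Q)"
    if st: "s \<le> t" "\<bar>s\<bar> < e" "\<bar>t\<bar> < e" "\<Phi> s Q \<notin> Sig" "\<Phi> t Q \<notin> Sig" for s t
  proof -
    have "s \<noteq> 0" "t \<noteq> 0"
      using that True by auto
    then consider "t < 0" | "s < 0" "0 < t" | "0 < s"
      using st by linarith
    then show ?thesis
    proof cases
      case 1
      have "\<Phi> t Q \<in> level (W (\<Phi> s Q))"
        by (rule curve_in_level[of "{-e<..<0}" "\<lambda>t. \<Phi> t Q" s])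
          (use st e 1 level_self in \<open>auto intro!: continuous_intros\<close>)
      then show ?thesis by (simp add: level_def)
    next
      case 2
      then show ?thesis
        using e(3)[of s t] st by auto
    next
      case 3
      have "\<Phi> t Q \<in> level (W (\<Phi> s Q))"
        by (rule curve_in_level[of "{0<..<e}" "\<lambda>t. \<Phi> t Q" s])
          (use st e 3 level_self in \<open>auto intro!: continuous_intros\<close>)
      then show ?thesis by (simp add: level_def)
    qed
  qed
  then show ?thesis
    using e(1) by blast
qed

text \<open>Bisection passes from local to global monotonicity. The delicate point is to join two
  intervals at a time when the pair lies in \<open>Sig\<close> and has no value.\<close>

lemma level_nonincreasing:
  assumes s: "\<Phi> s Q \<in> level k" and t: "\<Phi> t Q \<in> level l" and st: "s \<le> t"
  shows "l \<le> k"
proof -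
  have Q: "fst Q \<noteq> snd Q"
    using level_not_diagonal[OF s] by auto
  \<comment> \<open>Injectivity of the flow maps keeps the orbit off the diagonal, so
    \<open>W_drop\<close> applies at every crossing.\<close>
  then have Qb: "fst (\<Phi> b Q) \<noteq> snd (\<Phi> b Q)" for b
    by simp
  define P where "P a b \<longleftrightarrow> (\<forall>s t. a \<le> s \<longrightarrow> s \<le> t \<longrightarrow> t \<le> b \<longrightarrow> \<Phi> s Q \<notin> Sig \<longrightarrow> \<Phi> t Q \<notin> Sig \<longrightarrow>
    W (\<Phi> t Q) \<le> W (\<Phi> s Q))" for a b
  have shift: "\<Phi> (s - b) (\<Phi> b Q) = \<Phi> s Q" for s b
    using pair.flow_add[of "s - b" b Q] by simp
  have "P s t"
  proof (rule Bolzano[OF st])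
    fix a b c assume P: "P a b" "P b c" and "a \<le> b" "b \<le> c"
    show "P a c"
      unfolding P_def
    proof (intro allI impI)
      fix s t assume st: "a \<le> s" "s \<le> t" "t \<le> c" "\<Phi> s Q \<notin> Sig" "\<Phi> t Q \<notin> Sig"
      consider "t \<le> b" | "b \<le> s" | "s < b" "b < t" "\<Phi> b Q \<notin> Sig" | "s < b" "b < t" "\<Phi> b Q \<in> Sig"
        by linarith
      then show "W (\<Phi> t Q) \<le> W (\<Phi> s Q)"
      proof cases
        case 1 then show ?thesis using P(1) st by (auto simp: P_def)
      next
        case 2 then show ?thesis using P(2) st by (auto simp: P_def)
      next
        case 3
        then have "W (\<Phi> t Q) \<le> W (\<Phi> b Q)" "W (\<Phi> b Q) \<le> W (\<Phi> s Q)"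
          using P st by (auto simp: P_def)
        then show ?thesis by linarith
      next
        case 4
        obtain e where e: "e > 0" "\<And>s. s \<noteq> 0 \<Longrightarrow> \<bar>s\<bar> < e \<Longrightarrow> \<Phi> s (\<Phi> b Q) \<notin> Sig"
          "\<And>s t. - e < s \<Longrightarrow> s < 0 \<Longrightarrow> 0 < t \<Longrightarrow> t < e \<Longrightarrow> W (\<Phi> t (\<Phi> b Q)) < W (\<Phi> s (\<Phi> b Q))"
          using W_drop[OF 4(3) Qb] by blast
        \<comment> \<open>These times bypass the crossing at \<open>b\<close>: they stay inside its
          window and between \<open>s\<close> and \<open>t\<close>, so the drop links the two
          intervals.\<close>
        define s' t' where "s' = max s (b - e / 2)" and "t' = min t (b + e / 2)"
        have bounds: "s \<le> s'" "s' < b" "b - e < s'" "t' \<le> t" "b < t'" "t' < b + e"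
          using 4 e(1) by (auto simp: s'_def t'_def)
        have "\<Phi> s' Q \<notin> Sig" "\<Phi> t' Q \<notin> Sig" "W (\<Phi> t' Q) < W (\<Phi> s' Q)"
          using e(2)[of "s' - b"] e(2)[of "t' - b"] e(3)[of "s' - b" "t' - b"] bounds
          by (auto simp: shift)
        moreover from this have "W (\<Phi> t Q) \<le> W (\<Phi> t' Q)" "W (\<Phi> s' Q) \<le> W (\<Phi> s Q)"
          using P st bounds by (auto simp: P_def)
        ultimately show ?thesis by linarith
      qed
    qed
  next
    fix x
    obtain d where d: "d > 0" "\<And>s t. s \<le> t \<Longrightarrow> \<bar>s\<bar> < d \<Longrightarrow> \<bar>t\<bar> < d \<Longrightarrow>
        \<Phi> s (\<Phi> x Q) \<notin> Sig \<Longrightarrow> \<Phi> t (\<Phi> x Q) \<notin> Sig \<Longrightarrow> W (\<Phi> t (\<Phi> x Q)) \<le> W (\<Phi> s (\<Phi> x Q))"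
      using W_locally_nonincreasing[OF Qb[of x]] by blast
    have "P a b" if "a \<le> x" "x \<le> b" "b - a < d" for a b
      unfolding P_def
    proof (intro allI impI)
      fix s t assume st: "a \<le> s" "s \<le> t" "t \<le> b" "\<Phi> s Q \<notin> Sig" "\<Phi> t Q \<notin> Sig"
      then show "W (\<Phi> t Q) \<le> W (\<Phi> s Q)"
        using that d(2)[of "s - x" "t - x"] by (auto simp: shift)
    qed
    then show "\<exists>d>0. \<forall>a b. a \<le> x \<and> x \<le> b \<and> b - a < d \<longrightarrow> P a b"
      using d(1) by blast
  qed
  then show ?thesis
    using s t st by (auto simp: P_def level_def)
qed

text \<open>Levels are open and the flow is continuous, so the drop across \<open>Q\<close> is
  shared by all nearby pairs at the same two times.\<close>

lemma crossing_neighbourhood: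
  assumes "Q \<in> Sig" "fst Q \<noteq> snd Q"
  obtains e k l N where "e > 0" "l < k" "open N" "Q \<in> N"
    "\<And>R. R \<in> N \<Longrightarrow> \<Phi> (- e) R \<in> level k" "\<And>R. R \<in> N \<Longrightarrow> \<Phi> e R \<in> level l"
proof -
  obtain e where e: "e > 0" "\<And>s. s \<noteq> 0 \<Longrightarrow> \<bar>s\<bar> < e \<Longrightarrow> \<Phi> s Q \<notin> Sig"
    "\<And>s t. - e < s \<Longrightarrow> s < 0 \<Longrightarrow> 0 < t \<Longrightarrow> t < e \<Longrightarrow> W (\<Phi> t Q) < W (\<Phi> s Q)"
    using W_drop[OF assms] by blast
  \<comment> \<open>Half of \<open>e\<close> lies strictly inside the window of
    \<open>W_drop\<close>.\<close>
  define k l N where "k = W (\<Phi> (- (e / 2)) Q)" and "l = W (\<Phi> (e / 2) Q)"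
    and "N = \<Phi> (- (e / 2)) -` level k \<inter> \<Phi> (e / 2) -` level l"
  show thesis
  proof (rule that)
    show "e / 2 > 0" using e by simp
    show "l < k" using e(1) by (auto simp: k_def l_def intro!: e(3))
    show "open N"
      unfolding N_def
      by (intro open_Int open_vimage open_level continuous_intros)
    show "Q \<in> N"
      using e(1) e(2)[of "e / 2"] e(2)[of "- (e / 2)"]
      by (auto simp: N_def k_def l_def simp del: pair_flow_simps intro!: level_self)
  qed (auto simp: N_def)
qed

text \<open>
  A simultaneous return of both coordinates to neighbourhoods of a crossing would make the lower value
  of \<open>W\<close>, taken just after the first visit, precede the higher one, taken just before the second.
\<close>

lemma crossing_no_common_return:
  assumes "(x, y) \<in> Sig" "x \<noteq> y"
  obtains L N N' where "L > 0" "open N" "x \<in> N" "open N'" "y \<in> N'"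
    "\<And>\<theta> p q. \<theta> \<ge> L \<Longrightarrow> p \<in> N \<Longrightarrow> \<phi> \<theta> p \<in> N \<Longrightarrow> q \<in> N' \<Longrightarrow> \<phi> \<theta> q \<in> N' \<Longrightarrow> False"
proof -
  have "fst (x, y) \<noteq> snd (x, y)"
    using assms by simp
  with assms(1) obtain e k l O' where e: "e > 0" "l < k" "open O'" "(x, y) \<in> O'"
    "\<And>R. R \<in> O' \<Longrightarrow> \<Phi> (- e) R \<in> level k" "\<And>R. R \<in> O' \<Longrightarrow> \<Phi> e R \<in> level l"
    by (rule crossing_neighbourhood) blast
  obtain N N' where N: "open N" "open N'" "(x, y) \<in> N \<times> N'" "N \<times> N' \<subseteq> O'"
    by (rule open_prod_elim[OF e(3,4)])
  show thesis
  proof (rule that)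
    show "2 * e > 0" using e by simp
    fix \<theta> p q assume *: "\<theta> \<ge> 2 * e" "p \<in> N" "\<phi> \<theta> p \<in> N" "q \<in> N'" "\<phi> \<theta> q \<in> N'"
    have "\<Phi> e (p, q) \<in> level l"
      using * N by (intro e) auto
    moreover have "\<Phi> (- e) (\<Phi> \<theta> (p, q)) \<in> level k"
      using * N by (intro e) auto
    then have "\<Phi> (\<theta> - e) (p, q) \<in> level k"
      using pair.flow_add[of "- e" \<theta> "(p, q)"] by simp
    ultimately show False
      using level_nonincreasing[of e "(p, q)" l "\<theta> - e" k] * e by simp
  qed (use N in auto)
qed

text \<open>Reversing time interchanges before and after a crossing, and the change of sign restores
  the direction of the drop.\<close>

lemma discrete_lyapunov_flow_reverse:
  "discrete_lyapunov_flow (\<lambda>s. \<phi> (- s)) Sig (\<lambda>Q. - W Q)"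
proof (rule discrete_lyapunov_flow.intro[OF compact_flow_reverse], unfold_locales)
  show "continuous_on (- Sig) (\<lambda>Q. - W Q)"
    using continuous_on_compose2[OF _ continuous_W, of UNIV uminus] by simp
  fix Q assume "Q \<in> Sig" "fst Q \<noteq> snd Q"
  then obtain e where e: "e > 0" "\<And>s. s \<noteq> 0 \<Longrightarrow> \<bar>s\<bar> < e \<Longrightarrow> \<Phi> s Q \<notin> Sig"
    "\<And>s t. - e < s \<Longrightarrow> s < 0 \<Longrightarrow> 0 < t \<Longrightarrow> t < e \<Longrightarrow> W (\<Phi> t Q) < W (\<Phi> s Q)"
    using W_drop by blast
  show "\<exists>e>0. (\<forall>s. s \<noteq> 0 \<longrightarrow> \<bar>s\<bar> < e \<longrightarrow> pair_flow (\<lambda>s. \<phi> (- s)) s Q \<notin> Sig) \<and>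
        (\<forall>s t. - e < s \<longrightarrow> s < 0 \<longrightarrow> 0 < t \<longrightarrow> t < e \<longrightarrow>
          - W (pair_flow (\<lambda>s. \<phi> (- s)) t Q) < - W (pair_flow (\<lambda>s. \<phi> (- s)) s Q))"
    using e(1) e(2)[of "- s" for s] e(3)[of "- t" "- s" for s t]
    by (intro exI[of _ e]) (auto simp: pair_flow_def)
qed (use closed_Sig diagonal_in_Sig W_sym in auto)

end

section \<open>Pairs with a point in a minimal set\<close>

text \<open>
  The requirement on \<open>u\<close> admits visits in the distant past instead of the distant future, so that the
  locale is stable under reversal of time.
\<close>

locale visited_set = discrete_lyapunov_flow \<phi> Sig W
  for \<phi> :: "real \<Rightarrow> 'a::t2_space \<Rightarrow> 'a" and Sig W +
  fixes \<Omega> :: "'a set" and u :: 'a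
  assumes closed_Omega: "closed \<Omega>"
    and invariant_Omega: "invariant \<Omega>"
    and connected_Omega: "connected \<Omega>"
    and visits: "(\<forall>x\<in>\<Omega>. \<forall>N T. open N \<longrightarrow> x \<in> N \<longrightarrow> (\<exists>s\<ge>T. \<phi> s u \<in> N)) \<or>
      (\<forall>x\<in>\<Omega>. \<forall>N T. open N \<longrightarrow> x \<in> N \<longrightarrow> (\<exists>s\<le>T. \<phi> s u \<in> N))"
begin

text \<open>If \<open>u\<close> visits in the distant future, the later visit is chosen second and
  far enough ahead; if in the distant past, the earlier one is chosen second and far enough
  back.\<close>

lemma consecutive_visits:
  assumes "x \<in> \<Omega>" "open N" "x \<in> N" "y \<in> \<Omega>" "open N'" "y \<in> N'"
  obtains p \<theta> where "\<theta> \<ge> L" "p \<in> N" "\<phi> \<theta> p \<in> N'"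
proof -
  from visits have "\<exists>s t. t - s \<ge> L \<and> \<phi> s u \<in> N \<and> \<phi> t u \<in> N'"
  proof
    assume *: "\<forall>x\<in>\<Omega>. \<forall>N T. open N \<longrightarrow> x \<in> N \<longrightarrow> (\<exists>s\<ge>T. \<phi> s u \<in> N)"
    obtain s where "\<phi> s u \<in> N"
      using * assms by blast
    moreover obtain t where "t \<ge> s + L" "\<phi> t u \<in> N'"
      using * assms by blast
    ultimately show ?thesis
      by (intro exI[of _ s] exI[of _ t]) auto
  next
    assume *: "\<forall>x\<in>\<Omega>. \<forall>N T. open N \<longrightarrow> x \<in> N \<longrightarrow> (\<exists>s\<le>T. \<phi> s u \<in> N)"
    obtain t where "\<phi> t u \<in> N'"
      using * assms by blast
    moreover obtain s where "s \<le> t - L" "\<phi> s u \<in> N"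
      using * assms by blast
    ultimately show ?thesis
      by (intro exI[of _ s] exI[of _ t]) auto
  qed
  then obtain s t where "t - s \<ge> L" "\<phi> s u \<in> N" "\<phi> t u \<in> N'"
    by blast
  moreover have "\<phi> (t - s) (\<phi> s u) = \<phi> t u"
    by (simp flip: flow_add)
  ultimately show thesis
    using that[of "t - s" "\<phi> s u"] by simp
qed

text \<open>Visit times are chosen with absolute values growing by at least \<open>L\<close>, which
  treats both time directions alike.\<close>

lemma spaced_visits:
  assumes "x \<in> \<Omega>" "open N" "x \<in> N" "L > 0"
  obtains f :: "nat \<Rightarrow> real" where
    "\<And>i. \<phi> (f i) u \<in> N" "\<And>i j. i < j \<Longrightarrow> \<bar>f j - f i\<bar> \<ge> L"
proof -
  have *: "\<exists>s. \<bar>s\<bar> \<ge> T \<and> \<phi> s u \<in> N" for T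
    using visits
  proof
    assume "\<forall>x\<in>\<Omega>. \<forall>N T. open N \<longrightarrow> x \<in> N \<longrightarrow> (\<exists>s\<ge>T. \<phi> s u \<in> N)"
    then obtain s where "s \<ge> T" "\<phi> s u \<in> N"
      using assms by blast
    then show ?thesis
      by (intro exI[of _ s]) auto
  next
    assume "\<forall>x\<in>\<Omega>. \<forall>N T. open N \<longrightarrow> x \<in> N \<longrightarrow> (\<exists>s\<le>T. \<phi> s u \<in> N)"
    then obtain s where "s \<le> - T" "\<phi> s u \<in> N"
      using assms by blast
    then show ?thesis
      by (intro exI[of _ s]) auto
  qed
  have "\<exists>f. \<forall>n. \<phi> (f n) u \<in> N \<and> \<bar>f (Suc n)\<bar> \<ge> \<bar>f n\<bar> + L"
    using dependent_nat_choice[of "\<lambda>_ s. \<phi> s u \<in> N" "\<lambda>_ s t. \<bar>t\<bar> \<ge> \<bar>s\<bar> + L"] * by blast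
  then obtain f where f: "\<And>n. \<phi> (f n) u \<in> N" "\<And>n. \<bar>f (Suc n)\<bar> \<ge> \<bar>f n\<bar> + L"
    by blast
  have "\<bar>f i\<bar> + L \<le> \<bar>f j\<bar>" if "i < j" for i j
    using that
  proof (induction rule: strict_inc_induct)
    case (step i)
    then show ?case using f(2)[of i] assms(4) by linarith
  qed (use f in blast)
  then have "\<bar>f j - f i\<bar> \<ge> L" if "i < j" for i j
    using that by (smt (verit))
  then show thesis
    using that[of f] f(1) by blast
qed

text \<open>A return of \<open>p\<close> to a small neighbourhood of \<open>x\<close> carries along
  a return of \<open>\<phi> \<tau> p\<close>, so recurrence of a single point already gives the
  forbidden common return.\<close>

lemma same_orbit_not_in_Sig:
  assumes "x \<in> \<Omega>" "\<phi> \<tau> x \<noteq> x"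
  shows "(x, \<phi> \<tau> x) \<notin> Sig"
proof
  assume "(x, \<phi> \<tau> x) \<in> Sig"
  then obtain L N N' where L: "L > 0" and N: "open N" "x \<in> N" "open N'" "\<phi> \<tau> x \<in> N'"
    and no: "\<And>\<theta> p q. \<theta> \<ge> L \<Longrightarrow> p \<in> N \<Longrightarrow> \<phi> \<theta> p \<in> N \<Longrightarrow> q \<in> N' \<Longrightarrow> \<phi> \<theta> q \<in> N' \<Longrightarrow> False"
    using assms(2) by (elim crossing_no_common_return) auto
  have "open (N \<inter> \<phi> \<tau> -` N')" "x \<in> N \<inter> \<phi> \<tau> -` N'"
    using N by (auto intro!: open_vimage continuous_intros)
  then obtain p \<theta> where p: "\<theta> \<ge> L" "p \<in> N \<inter> \<phi> \<tau> -` N'" "\<phi> \<theta> p \<in> N \<inter> \<phi> \<tau> -` N'"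
    using consecutive_visits[of x "N \<inter> \<phi> \<tau> -` N'" x "N \<inter> \<phi> \<tau> -` N'" L thesis] assms(1)
    by simp
  have "\<phi> \<theta> (\<phi> \<tau> p) = \<phi> \<tau> (\<phi> \<theta> p)"
    by (simp add: add.commute flip: flow_add)
  then show False
    using no[of \<theta> p "\<phi> \<tau> p"] p by simp
qed

text \<open>
  Finitely many time shifts of the neighbourhood of \<open>y\<close> cover the minimal set, so by the pigeonhole
  principle two of the visits of \<open>u\<close> to the neighbourhood of \<open>x\<close> are matched by visits to that of \<open>y\<close>.
\<close>

lemma minimal_not_in_Sig:
  assumes x: "x \<in> \<Omega>" and M: "minimal M" and y: "y \<in> M" and xy: "x \<noteq> y"
  shows "(x, y) \<notin> Sig"
proof
  assume "(x, y) \<in> Sig"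
  then obtain L N N' where L: "L > 0" and N: "open N" "x \<in> N" "open N'" "y \<in> N'"
    and no: "\<And>\<theta> p q. \<theta> \<ge> L \<Longrightarrow> p \<in> N \<Longrightarrow> \<phi> \<theta> p \<in> N \<Longrightarrow> q \<in> N' \<Longrightarrow> \<phi> \<theta> q \<in> N' \<Longrightarrow> False"
    using xy by (elim crossing_no_common_return) auto
  obtain f :: "nat \<Rightarrow> real" where f: "\<And>i. \<phi> (f i) u \<in> N" "\<And>i j. i < j \<Longrightarrow> \<bar>f j - f i\<bar> \<ge> L"
    using spaced_visits[OF x N(1,2) L] by blast
  have "M \<subseteq> (\<Union>r\<in>UNIV. \<phi> r -` N')"
  proof
    fix z assume "z \<in> M"
    then have "y \<in> closure (range (\<lambda>s. \<phi> s z))"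
      using M y by (auto simp: minimal_def orbit_closure_def)
    then have "N' \<inter> range (\<lambda>s. \<phi> s z) \<noteq> {}"
      using N open_Int_closure_eq_empty by blast
    then show "z \<in> (\<Union>r\<in>UNIV. \<phi> r -` N')"
      by auto
  qed
  moreover have "compact M"
    using M closed_compact by (auto simp: minimal_def)
  moreover have "open (\<phi> r -` N')" for r
    by (intro open_vimage N continuous_intros)
  ultimately obtain R where R: "finite R" "M \<subseteq> (\<Union>r\<in>R. \<phi> r -` N')"
    using compactE_image[of M UNIV "\<lambda>r. \<phi> r -` N'"] by metis
  have "\<phi> (f i) y \<in> M" for i
    using M y by (auto simp: minimal_def dest: invariantD)
  then have "\<forall>i. \<exists>r\<in>R. \<phi> r (\<phi> (f i) y) \<in> N'"
    using R by blast
  then obtain c where c: "\<And>i. c i \<in> R" "\<And>i. \<phi> (c i) (\<phi> (f i) y) \<in> N'"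
    by metis
  have "finite (range c)"
    using c(1) R(1) by (auto intro: finite_subset)
  then have "\<not> inj c"
    using finite_imageD infinite_UNIV_nat by blast
  then obtain i j where "i \<noteq> j" "c i = c j"
    by (auto simp: inj_def)
  \<comment> \<open>Exchanging the indices if necessary makes the time difference positive.\<close>
  then have "\<exists>i j. c i = c j \<and> f j - f i \<ge> L"
    using f(2)[of i j] f(2)[of j i] by (smt (verit) linorder_neqE_nat)
  then obtain i j where ij: "c i = c j" "f j - f i \<ge> L"
    by blast
  show False
  proof (rule no)
    show "f j - f i \<ge> L" by fact
    show "\<phi> (f i) u \<in> N" "\<phi> (f j - f i) (\<phi> (f i) u) \<in> N"
      using f(1) by (simp_all flip: flow_add)
    show "\<phi> (c i) (\<phi> (f i) y) \<in> N'"
      by (rule c)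
    \<comment> \<open>Flow times commute and \<open>c i = c j\<close>, so this point is
      \<open>\<phi> (c j) (\<phi> (f j) y)\<close>.\<close>
    show "\<phi> (f j - f i) (\<phi> (c i) (\<phi> (f i) y)) \<in> N'"
      using c(2)[of j] ij by (simp add: algebra_simps flip: flow_add)
  qed
qed

text \<open>For fixed \<open>x\<close> the slice over the connected set \<open>M\<close> avoids
  \<open>Sig\<close>, so \<open>W\<close> is constant on it. While \<open>u\<close> moves from near
  \<open>x\<close> to near \<open>x'\<close>, a companion point stays in the invariant set
  \<open>M\<close>, so the value cannot increase; exchanging \<open>x\<close> and \<open>x'\<close>
  gives equality.\<close>

lemma W_constant_outside_minimal:
  assumes M: "minimal M" "M \<subseteq> \<Omega>"
  obtains a where "\<And>x y. x \<in> \<Omega> - M \<Longrightarrow> y \<in> M \<Longrightarrow> (x, y) \<in> level a"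
proof -
  obtain m where m: "m \<in> M"
    using M by (auto simp: minimal_def)
  have sub: "{x} \<times> M \<subseteq> level (W (x, m))" if x: "x \<in> \<Omega> - M" for x
  proof (rule connected_subset_level)
    have "M = orbit_closure m"
      using M m by (auto simp: minimal_def)
    then show "connected ({x} \<times> M)"
      using connected_orbit_closure by (intro connected_Times) auto
    show "{x} \<times> M \<inter> Sig = {}"
      using x minimal_not_in_Sig[OF _ M(1)] by auto
    then show "(x, m) \<in> level (W (x, m))"
      using m by (intro level_self) auto
  qed (use m in auto)
  have le: "W (x', m) \<le> W (x, m)" if x: "x \<in> \<Omega> - M" "x' \<in> \<Omega> - M" for x x'
  proof -
    have "compact M"
      using M closed_compact by (auto simp: minimal_def)
    \<comment> \<open>The tube lemma gives neighbourhoods that work for all of \<open>M\<close> at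
      once, since the position of \<open>\<phi> \<theta> m\<close> within \<open>M\<close> is not
      controlled.\<close>
    then obtain N N' where N: "x \<in> N" "open N" "N \<times> M \<subseteq> level (W (x, m))"
        and N': "x' \<in> N'" "open N'" "N' \<times> M \<subseteq> level (W (x', m))"
      using Elementary_Topology.tube_lemma[OF _ open_level sub[OF x(1)]]
        Elementary_Topology.tube_lemma[OF _ open_level sub[OF x(2)]]
      by blast
    obtain p \<theta> where p: "\<theta> \<ge> 0" "p \<in> N" "\<phi> \<theta> p \<in> N'"
      using consecutive_visits[of x N x' N' 0 thesis] N N' x by simp
    have "\<phi> \<theta> m \<in> M"
      using M m by (auto simp: minimal_def dest: invariantD)
    then have "\<Phi> 0 (p, m) \<in> level (W (x, m))" "\<Phi> \<theta> (p, m) \<in> level (W (x', m))"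
      using p m N N' by auto
    then show ?thesis
      using p(1) level_nonincreasing by blast
  qed
  show thesis
  proof (cases "\<Omega> - M = {}")
    case True
    \<comment> \<open>The claim is vacuous here, and 0 is an arbitrary choice.\<close>
    then show ?thesis
      using that[of 0] by blast
  next
    case False
    then obtain x where x: "x \<in> \<Omega> - M"
      by blast
    show ?thesis
    proof (rule that)
      fix z y assume z: "z \<in> \<Omega> - M" "y \<in> M"
      then have "W (z, m) = W (x, m)"
        using le[OF z(1) x] le[OF x z(1)] by simp
      then show "(z, y) \<in> level (W (x, m))"
        using sub[OF z(1)] z by auto
    qed
  qed
qed

text \<open>Connectedness of \<open>\<Omega>\<close> makes the closure meet \<open>M\<close>; being
  closed and invariant, it then contains all of the minimal set \<open>M\<close>.\<close>

lemma minimal_subset_closure_complement: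
  assumes M: "minimal M" "M \<subseteq> \<Omega>" "M \<noteq> \<Omega>"
  shows "M \<subseteq> closure (\<Omega> - M)"
proof -
  have "invariant M"
    using M by (simp add: minimal_def)
  then have "invariant (\<Omega> - M)"
    unfolding invariant_def[of "\<Omega> - M"] using invariantD[OF invariant_Omega]
    by (simp add: invariant_iff)
  then have inv: "invariant (closure (\<Omega> - M))"
    by (rule invariant_closure)
  have "M \<inter> closure (\<Omega> - M) \<noteq> {}"
  proof
    assume *: "M \<inter> closure (\<Omega> - M) = {}"
    have "M \<inter> \<Omega> = {} \<or> closure (\<Omega> - M) \<inter> \<Omega> = {}"
    proof (rule connected_closedD[OF connected_Omega])
      show "\<Omega> \<subseteq> M \<union> closure (\<Omega> - M)"
        using closure_subset[of "\<Omega> - M"] by blast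
    qed (use M * in \<open>auto simp: minimal_def\<close>)
    moreover have "\<Omega> - M \<subseteq> closure (\<Omega> - M)"
      by (rule closure_subset)
    ultimately show False
      using M by (auto simp: minimal_def)
  qed
  then obtain z where "z \<in> M" "z \<in> closure (\<Omega> - M)"
    by blast
  then show ?thesis
    using orbit_closure_subset[OF _ inv, of z] M by (auto simp: minimal_def)
qed

text \<open>A pair inside \<open>M\<close> is approximated by pairs with first point in
  \<open>\<Omega> - M\<close>, and openness of the levels transfers the constant.\<close>

lemma W_constant_with_minimal:
  assumes M: "minimal M" "M \<subseteq> \<Omega>" "M \<noteq> \<Omega>"
  obtains a where "\<And>x y. x \<in> \<Omega> \<Longrightarrow> y \<in> M \<Longrightarrow> x \<noteq> y \<Longrightarrow> (x, y) \<in> level a"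
proof -
  obtain a where a: "\<And>x y. x \<in> \<Omega> - M \<Longrightarrow> y \<in> M \<Longrightarrow> (x, y) \<in> level a"
    using W_constant_outside_minimal[OF M(1,2)] by blast
  show thesis
  proof (rule that)
    fix x y assume xy: "x \<in> \<Omega>" "y \<in> M" "x \<noteq> y"
    have level: "(x, y) \<in> level (W (x, y))"
      using minimal_not_in_Sig[OF xy(1) M(1) xy(2,3)] by (rule level_self)
    show "(x, y) \<in> level a"
    proof (cases "x \<in> M")
      case True
      have "open ((\<lambda>x. (x, y)) -` level (W (x, y)))"
        by (intro open_vimage open_level continuous_intros)
      then have "(\<lambda>x. (x, y)) -` level (W (x, y)) \<inter> (\<Omega> - M) \<noteq> {}"
        using True minimal_subset_closure_complement[OF M] level open_Int_closure_eq_empty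
        by blast
      then obtain p where "p \<in> \<Omega> - M" "(p, y) \<in> level (W (x, y))"
        by auto
      then show ?thesis
        using a[of p y] xy level level_unique by metis
    qed (use a xy in auto)
  qed
qed

text \<open>The constants of two distinct minimal sets agree, because a pair with one point in each
  is governed by both.\<close>

lemma W_constant_with_recurrent:
  assumes "\<not> minimal \<Omega>"
  obtains a where "\<And>M x y. minimal M \<Longrightarrow> M \<subseteq> \<Omega> \<Longrightarrow> x \<in> \<Omega> \<Longrightarrow> y \<in> M \<Longrightarrow> x \<noteq> y \<Longrightarrow>
    (x, y) \<in> level a"
proof (cases "\<Omega> = {}")
  case True
  then show ?thesis using that[of 0] by blast
next
  case False
  then obtain M where M: "minimal M" "M \<subseteq> \<Omega>"
    using minimal_exists[OF closed_Omega invariant_Omega] by blast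
  then obtain a where a: "\<And>x y. x \<in> \<Omega> \<Longrightarrow> y \<in> M \<Longrightarrow> x \<noteq> y \<Longrightarrow> (x, y) \<in> level a"
    using W_constant_with_minimal[of M] assms by blast
  show ?thesis
  proof (rule that)
    fix M' x y assume M': "minimal M'" "M' \<subseteq> \<Omega>" and xy: "x \<in> \<Omega>" "y \<in> M'" "x \<noteq> y"
    show "(x, y) \<in> level a"
    proof (cases "M = M'")
      case False
      obtain b where b: "\<And>x y. x \<in> \<Omega> \<Longrightarrow> y \<in> M' \<Longrightarrow> x \<noteq> y \<Longrightarrow> (x, y) \<in> level b"
        using W_constant_with_minimal[of M'] M' assms by blast
      obtain m m' where m: "m \<in> M" "m' \<in> M'"
        using M M' by (auto simp: minimal_def)
      have "m \<noteq> m'"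
        using m M M' False minimal_disjoint by blast
      then have "(m', m) \<in> level a" "(m', m) \<in> level b"
        using a[of m' m] b[of m m'] m M M' level_commute[of m m'] by auto
      then show ?thesis
        using b[OF xy] level_unique by metis
    qed (use a xy in auto)
  qed
qed

end

section \<open>Pairs with a low value of \<open>W\<close>\<close>

text \<open>\<open>R\<close> stands for the union of the minimal subsets of \<open>\<Omega>\<close>.
  The properties recorded are ones that transfer directly to the reversed flow.\<close>

locale visited_set_with_core = visited_set \<phi> Sig W \<Omega> u
  for \<phi> :: "real \<Rightarrow> 'a::t2_space \<Rightarrow> 'a" and Sig W \<Omega> u +
  fixes R :: "'a set" and a :: int
  assumes invariant_core: "invariant R"
    and core_level: "x \<in> \<Omega> \<Longrightarrow> y \<in> R \<Longrightarrow> x \<noteq> y \<Longrightarrow> (x, y) \<in> level a"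
    and equilibrium_in_core: "x \<in> \<Omega> \<Longrightarrow> equilibrium x \<Longrightarrow> x \<in> R"
    and core_meets: "closed C \<Longrightarrow> invariant C \<Longrightarrow> C \<noteq> {} \<Longrightarrow> C \<subseteq> \<Omega> \<Longrightarrow> C \<inter> R \<noteq> {}"
begin

text \<open>In \<open>R\<close>, any small shift that moves \<open>p\<close> will do. Otherwise
  \<open>p\<close> is aperiodic and its orbit closure contains a point of \<open>R\<close>, so some
  shift has the value \<open>a\<close>; as no nonzero shift gives a pair in \<open>Sig\<close>, the
  value is the same for all shifts of that sign.\<close>

lemma small_shift_level:
  assumes p: "p \<in> \<Omega>" "\<not> equilibrium p" and \<delta>: "\<delta> > 0"
  obtains c where "\<bar>c\<bar> < \<delta>" "(\<phi> c p, p) \<in> level a"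
proof (cases "p \<in> R")
  case True
  obtain c where c: "\<bar>c\<bar> < \<delta>" "\<phi> c p \<noteq> p"
    using p(2) equilibrium_if_small_periods[OF \<delta>] by blast
  then have "(\<phi> c p, p) \<in> level a"
    using True p(1) by (intro core_level invariantD[OF invariant_Omega]) auto
  then show thesis
    using that c by blast
next
  case False
  have "orbit_closure p \<subseteq> \<Omega>"
    by (rule orbit_closure_subset[OF closed_Omega invariant_Omega p(1)])
  moreover have "orbit_closure p \<noteq> {}"
    using orbit_closure_self by blast
  ultimately obtain m where m: "m \<in> orbit_closure p" "m \<in> R"
    using core_meets[OF closed_orbit_closure invariant_orbit_closure] by blast
  have aperiodic: "\<phi> c p \<noteq> p" if c: "c \<noteq> 0" for c
  proof
    assume "\<phi> c p = p"
    then obtain s where "m = \<phi> s p"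
      using orbit_closure_periodic[OF c] m(1) by auto
    then have "p = \<phi> (- s) m"
      by simp
    then show False
      using False m(2) invariantD[OF invariant_core] by blast
  qed
  have off: "(p, \<phi> c p) \<notin> Sig" if "c \<noteq> 0" for c
    using same_orbit_not_in_Sig[OF p(1)] aperiodic[OF that] .
  have "(p, m) \<in> level a"
    using m False p(1) by (intro core_level) auto
  moreover have "open ((\<lambda>y. (p, y)) -` level a)"
    by (intro open_vimage open_level continuous_intros)
  ultimately have "((\<lambda>y. (p, y)) -` level a) \<inter> range (\<lambda>s. \<phi> s p) \<noteq> {}"
    using m(1) open_Int_closure_eq_empty unfolding orbit_closure_def by blast
  then obtain c where c: "(p, \<phi> c p) \<in> level a"
    by auto
  then have "c \<noteq> 0"
    using level_not_diagonal by fastforce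
  \<comment> \<open>The half-line containing \<open>c\<close> avoids 0, where the pair is diagonal,
    and \<open>d\<close> is a short shift in it.\<close>
  define I where "I = (if c > 0 then {0<..} else {..<0::real})"
  define d where "d = (if c > 0 then \<delta> / 2 else - (\<delta> / 2))"
  have "(p, \<phi> d p) \<in> level a"
  proof (rule curve_in_level[of I "\<lambda>d. (p, \<phi> d p)" c])
    show "continuous_on I (\<lambda>d. (p, \<phi> d p))"
      by (intro continuous_intros)
    show "connected I"
      by (simp add: I_def)
    show "(p, \<phi> t p) \<notin> Sig" if "t \<in> I" for t
      using that off[of t] by (auto simp: I_def split: if_splits)
  qed (use c \<open>c \<noteq> 0\<close> \<delta> in \<open>auto simp: I_def d_def\<close>)
  then show thesis
    using that[of d] \<delta> level_commute by (auto simp: d_def)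
qed

lemma not_in_Sig_later:
  assumes "fst Q \<noteq> snd Q"
  obtains s where "s \<ge> 0" "\<Phi> s Q \<notin> Sig"
proof (cases "Q \<in> Sig")
  case True
  then obtain e where "e > 0" "\<And>s. s \<noteq> 0 \<Longrightarrow> \<bar>s\<bar> < e \<Longrightarrow> \<Phi> s Q \<notin> Sig"
    using W_drop[OF True assms] by blast
  then show thesis
    using that[of "e / 2"] by simp
next
  case False
  then show thesis
    using that[of 0] by simp
qed

section \<open>Limit sets of pairs under the product flow\<close>

definition pair_limit :: "'a \<Rightarrow> 'a \<Rightarrow> ('a \<times> 'a) set" where
  "pair_limit x y = limit_set (\<lambda>s. \<Phi> s (x, y))"

lemma closed_pair_limit: "closed (pair_limit x y)"
  by (simp only: pair_limit_def closed_limit_set)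

lemma pair_limitD:
  assumes "Q \<in> pair_limit x y" "open N" "Q \<in> N"
  obtains s where "s \<ge> T" "\<Phi> s (x, y) \<in> N"
  using assms unfolding pair_limit_def by (rule limit_setD)

lemma pair_limit_Int_nonempty:
  assumes "closed F" "\<And>T. \<exists>s\<ge>T. \<Phi> s (x, y) \<in> F"
  shows "F \<inter> pair_limit x y \<noteq> {}"
  unfolding pair_limit_def
  by (rule limit_set_Int_nonempty[OF pair.closed_compact[OF assms(1)] assms(2)])

lemma invariant_pair_limit: "Q \<in> pair_limit x y \<Longrightarrow> \<Phi> s Q \<in> pair_limit x y"
  unfolding pair_limit_def by (rule pair.invariantD[OF pair.invariant_limit_set])

context
  fixes w1 w2 k
  assumes w: "w1 \<in> \<Omega>" "w2 \<in> \<Omega>" "(w1, w2) \<in> level k" and k: "k < a"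
begin

abbreviation (input) "\<omega> \<equiv> pair_limit w1 w2"

lemma pair_limit_subset: "\<omega> \<subseteq> \<Omega> \<times> \<Omega>"
  unfolding pair_limit_def
  by (rule limit_set_subset)
    (use w closed_Omega invariantD[OF invariant_Omega] in \<open>auto intro!: closed_Times\<close>)

text \<open>The pair keeps returning near \<open>Q\<close>. At a crossing, the value after one visit
  would lie below the value before a much later one, against monotonicity; off \<open>Sig\<close>,
  the value at \<open>Q\<close> is attained at a nonnegative time and is thus at most
  \<open>k\<close>.\<close>

lemma pair_limit_level:
  assumes Q: "Q \<in> \<omega>" "fst Q \<noteq> snd Q"
  shows "\<exists>k'\<le>k. Q \<in> level k'"
proof (cases "Q \<in> Sig")
  case True
  obtain e l' l N where e: "e > 0" "l < l'" "open N" "Q \<in> N"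
    "\<And>P. P \<in> N \<Longrightarrow> \<Phi> (- e) P \<in> level l'" "\<And>P. P \<in> N \<Longrightarrow> \<Phi> e P \<in> level l"
    by (rule crossing_neighbourhood[OF True Q(2)]) blast
  obtain s where s: "\<Phi> s (w1, w2) \<in> N"
    by (rule pair_limitD[OF Q(1) e(3,4)])
  obtain t where t: "t \<ge> s + 2 * e" "\<Phi> t (w1, w2) \<in> N"
    by (rule pair_limitD[OF Q(1) e(3,4)])
  have "\<Phi> (e + s) (w1, w2) \<in> level l" "\<Phi> (- e + t) (w1, w2) \<in> level l'"
    using e(5,6) s t(2) by (simp_all only: pair.flow_add)
  then have "l' \<le> l"
    using t(1) level_nonincreasing[of "e + s" "(w1, w2)" l "- e + t" l'] by simp
  then show ?thesis
    using e(2) by simp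
next
  case False
  obtain s where "s \<ge> 0" "\<Phi> s (w1, w2) \<in> level (W Q)"
    by (rule pair_limitD[OF Q(1) open_level level_self[OF False]])
  then have "W Q \<le> k"
    using level_nonincreasing[of 0 "(w1, w2)" k s] w(3) by simp
  then show ?thesis
    using level_self[OF False] by blast
qed

text \<open>
  If the pair approaches \<open>(p, p)\<close> and \<open>p\<close> moves, then shifting the first coordinate slightly in time
  brings the pair close to \<open>(\<phi> c p, p)\<close>, where \<open>W\<close> is larger than at the start.
\<close>

lemma pair_limit_equilibrium:
  assumes p: "(p, p) \<in> \<omega>"
  shows "equilibrium p"
proof (rule ccontr)
  assume "\<not> equilibrium p"
  have "open ((\<lambda>c. (\<phi> c w1, w2)) -` level k)"
    by (intro open_vimage open_level continuous_intros)
  moreover have "0 \<in> (\<lambda>c. (\<phi> c w1, w2)) -` level k"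
    using w by simp
  ultimately obtain \<delta> where \<delta>: "\<delta> > 0" "ball 0 \<delta> \<subseteq> (\<lambda>c. (\<phi> c w1, w2)) -` level k"
    using openE by blast
  have "p \<in> \<Omega>"
    using p pair_limit_subset by blast
  then obtain c where c: "\<bar>c\<bar> < \<delta>" "(\<phi> c p, p) \<in> level a"
    using small_shift_level[OF _ \<open>\<not> equilibrium p\<close> \<delta>(1)] by blast
  have "c \<in> ball 0 \<delta>"
    using c(1) by simp
  then have "(\<phi> c w1, w2) \<in> level k"
    using \<delta>(2) by blast
  then have start: "\<Phi> 0 (\<phi> c w1, w2) \<in> level k"
    by simp
  have "open ((\<lambda>Q. (\<phi> c (fst Q), snd Q)) -` level a)"
    by (intro open_vimage open_level continuous_intros)
  moreover have "(p, p) \<in> (\<lambda>Q. (\<phi> c (fst Q), snd Q)) -` level a"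
    using c by simp
  ultimately obtain s where s: "s \<ge> 0" "\<Phi> s (w1, w2) \<in> (\<lambda>Q. (\<phi> c (fst Q), snd Q)) -` level a"
    by (rule pair_limitD[OF p])
  have "\<phi> c (\<phi> s w1) = \<phi> s (\<phi> c w1)"
    by (simp add: add.commute flip: flow_add)
  then have "\<Phi> s (\<phi> c w1, w2) \<in> level a"
    using s(2) by simp
  then show False
    using level_nonincreasing[OF start _ s(1)] k by fastforce
qed

text \<open>The first projection of the limit set is closed and invariant, so it contains a point of
  \<open>R\<close>. Off the diagonal, its pair would have both the value \<open>a\<close> and a
  value at most \<open>k\<close>.\<close>

lemma pair_limit_meets_diagonal: "\<exists>p. (p, p) \<in> \<omega>"
proof -
  have "compact \<omega>"
    by (rule pair.closed_compact[OF closed_pair_limit])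
  then have "closed (fst ` \<omega>)"
    by (intro compact_imp_closed compact_continuous_image continuous_intros)
  moreover have "invariant (fst ` \<omega>)"
    unfolding invariant_def
  proof (intro allI ballI)
    fix s x assume "x \<in> fst ` \<omega>"
    then obtain Q where "Q \<in> \<omega>" "x = fst Q"
      by blast
    then have "\<Phi> s Q \<in> \<omega>" "\<phi> s x = fst (\<Phi> s Q)"
      using invariant_pair_limit by auto
    then show "\<phi> s x \<in> fst ` \<omega>"
      by blast
  qed
  moreover have "fst ` \<omega> \<noteq> {}"
    using pair_limit_Int_nonempty[OF closed_UNIV] by auto
  moreover have "fst ` \<omega> \<subseteq> \<Omega>"
    using pair_limit_subset by auto
  ultimately obtain m y where m: "m \<in> R" "(m, y) \<in> \<omega>"
    using core_meets[of "fst ` \<omega>"] by force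
  have "m = y"
  proof (rule ccontr)
    assume "m \<noteq> y"
    then have "(m, y) \<in> level a"
      using m pair_limit_subset core_level[of y m] level_commute by blast
    moreover obtain k' where "k' \<le> k" "(m, y) \<in> level k'"
      using pair_limit_level[OF m(2)] \<open>m \<noteq> y\<close> by auto
    ultimately show False
      using level_unique[of "(m, y)" a k'] k by simp
  qed
  then show ?thesis
    using m by blast
qed

text \<open>
  Either the first coordinate of the pair itself eventually stays near \<open>A\<close>, or the last points
  outside \<open>U\<close> before ever longer stays in \<open>U\<close> accumulate at a point whose later orbit lies in
  \<open>closure U\<close>. In the second case this point is outside \<open>A\<close>, hence its pair is off the diagonal.
\<close>

lemma trapped_pair:
  assumes A: "A = {e. (e, e) \<in> \<omega>}" and U: "open U" "A \<subseteq> U"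
  obtains z z' k' where "z \<in> \<Omega>" "z' \<in> \<Omega>" "(z, z') \<in> level k'" "k' < a"
    "\<And>s. s > 0 \<Longrightarrow> \<phi> s z \<in> closure U"
proof (cases "\<exists>t. \<forall>s\<ge>t. \<phi> s w1 \<in> closure U")
  case True
  then obtain t where t: "\<And>s. s \<ge> t \<Longrightarrow> \<phi> s w1 \<in> closure U"
    by blast
  \<comment> \<open>A nonnegative starting time keeps the value of \<open>W\<close> at most
    \<open>k\<close>.\<close>
  define t' where "t' = max t 0"
  have "fst (\<Phi> t' (w1, w2)) \<noteq> snd (\<Phi> t' (w1, w2))"
    using level_not_diagonal[OF w(3)] by simp
  then obtain r where r: "r \<ge> 0" "\<Phi> r (\<Phi> t' (w1, w2)) \<notin> Sig"
    using not_in_Sig_later by blast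
  define s where "s = r + t'"
  have s: "s \<ge> t" "s \<ge> 0" "\<Phi> s (w1, w2) \<notin> Sig"
    using r pair.flow_add[of r t' "(w1, w2)"] by (auto simp: s_def t'_def)
  define l where "l = W (\<Phi> s (w1, w2))"
  have l: "\<Phi> s (w1, w2) \<in> level l"
    unfolding l_def by (rule level_self[OF s(3)])
  then have "l \<le> k"
    using level_nonincreasing[of 0 "(w1, w2)" k s] w(3) s(2) by simp
  show thesis
  proof (rule that)
    show "\<phi> s w1 \<in> \<Omega>" "\<phi> s w2 \<in> \<Omega>"
      using w invariantD[OF invariant_Omega] by auto
    show "(\<phi> s w1, \<phi> s w2) \<in> level l"
      using l by simp
    show "l < a"
      using \<open>l \<le> k\<close> k by simp
    show "\<phi> r (\<phi> s w1) \<in> closure U" if "r > 0" for r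
      using t[of "r + s"] that s(1) by (simp add: flow_add)
  qed
next
  case False
  \<comment> \<open>\<open>F t\<close> records a position outside \<open>U\<close> followed by a
    stay of length \<open>t\<close> in \<open>closure U\<close>; taking the closure makes these sets
    closed.\<close>
  define F :: "real \<Rightarrow> ('a \<times> 'a) set" where "F t = {Q. fst Q \<notin> U \<and> (\<forall>s. 0 < s \<longrightarrow> s \<le> t \<longrightarrow> \<phi> s (fst Q) \<in> closure U)}" for t
  have closed_F: "closed (F t)" for t
  proof -
    have "F t = fst -` (- U) \<inter> (\<Inter>s\<in>{0<..t}. (\<lambda>Q. \<phi> s (fst Q)) -` closure U)"
      by (auto simp: F_def)
    moreover have "closed ((fst :: 'a \<times> 'a \<Rightarrow> 'a) -` (- U))"
      "closed ((\<lambda>Q :: 'a \<times> 'a. \<phi> s (fst Q)) -` closure U)" for s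
      using U by (auto intro!: closed_vimage continuous_intros)
    ultimately show ?thesis
      by (simp add: closed_Int closed_INT)
  qed
  have exit: "\<exists>\<rho>\<ge>T. \<Phi> \<rho> (w1, w2) \<in> F t" for T t
  proof -
    obtain \<rho>0 where \<rho>0: "\<rho>0 \<ge> T" "\<phi> \<rho>0 w1 \<notin> closure U"
      using False by blast
    obtain e where e: "(e, e) \<in> \<omega>"
      using pair_limit_meets_diagonal by blast
    then have "equilibrium e" "e \<in> U"
      using pair_limit_equilibrium A U by auto
    have "open ((\<lambda>p. \<phi> (snd p) (fst p)) -` U)"
      by (intro open_vimage U continuous_intros)
    moreover have "{e} \<times> {0..\<bar>t\<bar>} \<subseteq> (\<lambda>p. \<phi> (snd p) (fst p)) -` U"
      using \<open>equilibrium e\<close> \<open>e \<in> U\<close> by (auto simp: equilibrium_def)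
    \<comment> \<open>Points close enough to the equilibrium \<open>e\<close> remain in
      \<open>U\<close> during the whole time interval.\<close>
    ultimately obtain B where B: "e \<in> B" "open B" "B \<times> {0..\<bar>t\<bar>} \<subseteq> (\<lambda>p. \<phi> (snd p) (fst p)) -` U"
      using Elementary_Topology.tube_lemma[OF compact_Icc, of "(\<lambda>p. \<phi> (snd p) (fst p)) -` U" e 0 "\<bar>t\<bar>"]
      by blast
    have "open (B \<times> (UNIV :: 'a set))" "(e, e) \<in> B \<times> UNIV"
      using B by (auto intro: open_Times)
    then obtain \<tau> where \<tau>: "\<tau> \<ge> \<rho>0" "\<Phi> \<tau> (w1, w2) \<in> B \<times> UNIV"
      by (rule pair_limitD[OF e])
    have stay: "\<phi> s w1 \<in> U" if "\<tau> \<le> s" "s \<le> \<tau> + \<bar>t\<bar>" for s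
    proof -
      have "(\<phi> \<tau> w1, s - \<tau>) \<in> B \<times> {0..\<bar>t\<bar>}"
        using \<tau> that by auto
      then have "\<phi> (s - \<tau>) (\<phi> \<tau> w1) \<in> U"
        using B(3) by fastforce
      then show ?thesis
        by (simp flip: flow_add)
    qed
    \<comment> \<open>The maximum of \<open>S\<close> is the last time outside \<open>U\<close>
      between the excursion at \<open>\<rho>0\<close> and the arrival near \<open>e\<close> at
      \<open>\<tau>\<close>.\<close>
    define S where "S = {\<rho>0..\<tau>} \<inter> (\<lambda>s. \<phi> s w1) -` (- U)"
    have "closed ((\<lambda>s. \<phi> s w1) -` (- U))"
      using U by (intro closed_vimage continuous_intros) auto
    then have "compact S"
      unfolding S_def by (rule compact_Int_closed[OF compact_Icc])
    moreover have "\<rho>0 \<in> S"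
      using \<rho>0 \<tau> closure_subset[of U] by (auto simp: S_def)
    ultimately obtain \<rho> where \<rho>: "\<rho> \<in> S" "\<And>s. s \<in> S \<Longrightarrow> s \<le> \<rho>"
      using compact_attains_sup[of S] by blast
    have "\<phi> s (\<phi> \<rho> w1) \<in> U" if "0 < s" "s \<le> t" for s
    proof -
      have "\<phi> (s + \<rho>) w1 \<in> U"
      proof (cases "s + \<rho> \<le> \<tau>")
        case True
        then have "s + \<rho> \<notin> S"
          using \<rho>(2)[of "s + \<rho>"] that by auto
        then show ?thesis
          using True \<rho>(1) that by (auto simp: S_def)
      next
        case False
        then show ?thesis
          using stay[of "s + \<rho>"] \<rho>(1) that by (auto simp: S_def)
      qed
      then show ?thesis
        by (simp add: flow_add)
    qed
    then have "\<Phi> \<rho> (w1, w2) \<in> F t"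
      using \<rho>(1) closure_subset[of U] by (auto simp: F_def S_def)
    moreover have "\<rho> \<ge> T"
      using \<rho>(1) \<rho>0 by (auto simp: S_def)
    ultimately show ?thesis
      by blast
  qed
  have "\<omega> \<inter> (\<Inter>t. F t) \<noteq> {}"
  proof (rule compact_decreasing_Inter_nonempty)
    show "compact \<omega>"
      by (rule pair.closed_compact[OF closed_pair_limit])
    show "\<omega> \<inter> F t \<noteq> {}" for t
      using pair_limit_Int_nonempty[OF closed_F exit] by (simp add: Int_commute)
    show "F t \<subseteq> F s" if "s \<le> t" for s t
      using that by (auto simp: F_def)
  qed (rule closed_F)
  then obtain z z' where z: "(z, z') \<in> \<omega>" "\<And>t. (z, z') \<in> F t"
    by auto
  have "z \<notin> A"
    using z(2) U by (auto simp: F_def)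
  then have "z \<noteq> z'"
    using z(1) A by auto
  then obtain k' where k': "k' \<le> k" "(z, z') \<in> level k'"
    using pair_limit_level[OF z(1)] by auto
  show thesis
  proof (rule that[OF _ _ k'(2)])
    show "z \<in> \<Omega>" "z' \<in> \<Omega>"
      using z(1) pair_limit_subset by auto
    show "k' < a"
      using k' k by simp
    show "\<phi> s z \<in> closure U" if "s > 0" for s
      using z(2)[of s] that by (auto simp: F_def)
  qed
qed

text \<open>
  A point \<open>p\<close> near \<open>z'\<close> that later visits the vicinity of \<open>w1\<close> contradicts monotonicity, since the
  trapped point \<open>z\<close> is then near \<open>A\<close>.
\<close>

lemma low_level_absurd: False
proof -
  define A where "A = {e. (e, e) \<in> \<omega>}"
  have "A = (\<lambda>e. (e, e)) -` \<omega>"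
    by (auto simp: A_def)
  moreover have "closed ((\<lambda>e. (e, e)) -` \<omega>)"
    by (intro closed_vimage closed_pair_limit continuous_intros)
  ultimately have "compact A"
    using closed_compact by simp
  have A: "e \<in> R" if "e \<in> A" for e
    using that pair_limit_subset pair_limit_equilibrium equilibrium_in_core by (auto simp: A_def)
  \<comment> \<open>This makes \<open>w1\<close> distinct from all points of \<open>A\<close>, so
    that \<open>core_level\<close> gives the value \<open>a\<close> on their pairs.\<close>
  have "w1 \<notin> R"
  proof
    assume "w1 \<in> R"
    then have "(w1, w2) \<in> level a"
      using w core_level[of w2 w1] level_commute[of w1 w2] level_not_diagonal[OF w(3)] by auto
    then show False
      using w(3) level_unique k by blast
  qed
  then have sub: "A \<subseteq> (\<lambda>x. (w1, x)) -` level a"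
    using A w core_level[of w1] by auto
  have "open ((\<lambda>x. (w1, x)) -` level a)"
    by (intro open_vimage open_level continuous_intros)
  \<comment> \<open>Separating \<open>A\<close> from the complement of the slice yields a
    neighbourhood of \<open>A\<close> whose closure still lies in the slice.\<close>
  then have "compact (- ((\<lambda>x. (w1, x)) -` level a))"
    by (intro closed_compact) auto
  then obtain U V where UV: "open U" "open V" "A \<subseteq> U" "- ((\<lambda>x. (w1, x)) -` level a) \<subseteq> V" "U \<inter> V = {}"
    by (rule compact_t2_separation[OF \<open>compact A\<close>]) (use sub in auto)
  have "closure U \<subseteq> - V"
    using UV by (intro closure_minimal) auto
  then have tube: "{w1} \<times> closure U \<subseteq> level a"
    using UV by auto
  obtain N where N: "w1 \<in> N" "open N" "N \<times> closure U \<subseteq> level a"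
    using Elementary_Topology.tube_lemma[OF closed_compact[OF closed_closure] open_level tube] by blast
  obtain z z' k' where z: "z \<in> \<Omega>" "z' \<in> \<Omega>" "(z, z') \<in> level k'" "k' < a"
      "\<And>s. s > 0 \<Longrightarrow> \<phi> s z \<in> closure U"
    by (rule trapped_pair[OF A_def UV(1,3)]) blast
  have "open ((\<lambda>y. (z, y)) -` level k')" "z' \<in> (\<lambda>y. (z, y)) -` level k'"
    using z by (auto intro!: open_vimage open_level continuous_intros)
  \<comment> \<open>The time must be positive, since \<open>z\<close> is known to be trapped only at
    positive times.\<close>
  then obtain p \<theta> where p: "\<theta> \<ge> 1" "p \<in> (\<lambda>y. (z, y)) -` level k'" "\<phi> \<theta> p \<in> N"
    using consecutive_visits[of z' "(\<lambda>y. (z, y)) -` level k'" w1 N 1 thesis] z(2) w(1) N by simp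
  have "\<Phi> 0 (z, p) \<in> level k'"
    using p(2) by simp
  moreover have "(\<phi> \<theta> p, \<phi> \<theta> z) \<in> level a"
    using p N(3) z(5)[of \<theta>] by auto
  then have "\<Phi> \<theta> (z, p) \<in> level a"
    using level_commute by simp
  ultimately have "a \<le> k'"
    using p(1) level_nonincreasing[of 0 "(z, p)" k' \<theta> a] by simp
  then show False
    using z(4) by simp
qed

end

end

section \<open>Injectivity on the limit set\<close>

context compact_flow
begin

lemma invariant_reverse: "compact_flow.invariant (\<lambda>s. \<phi> (- s)) S \<longleftrightarrow> invariant S"
  unfolding compact_flow.invariant_def[OF compact_flow_reverse] invariant_def
  by (metis minus_minus)

lemma equilibrium_reverse: "compact_flow.equilibrium (\<lambda>s. \<phi> (- s)) x \<longleftrightarrow> equilibrium x"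
  unfolding compact_flow.equilibrium_def[OF compact_flow_reverse] equilibrium_def
  by (metis minus_minus)

end

context discrete_lyapunov_flow
begin

lemma level_reverse: "discrete_lyapunov_flow.level Sig (\<lambda>Q. - W Q) (- k) = level k"
  unfolding discrete_lyapunov_flow.level_def[OF discrete_lyapunov_flow_reverse] level_def
  by simp

end

text \<open>The two alternatives of \<open>visits\<close> exchange places.\<close>

lemma (in visited_set) visited_set_reverse:
  "visited_set (\<lambda>s. \<phi> (- s)) Sig (\<lambda>Q. - W Q) \<Omega> u"
proof (rule visited_set.intro[OF discrete_lyapunov_flow_reverse], unfold_locales)
  show "compact_flow.invariant (\<lambda>s. \<phi> (- s)) \<Omega>"
    by (simp add: invariant_reverse invariant_Omega)
  have "(\<exists>s\<ge>T. \<phi> (- s) u \<in> N) \<longleftrightarrow> (\<exists>s\<le>-T. \<phi> s u \<in> N)"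
    "(\<exists>s\<le>T. \<phi> (- s) u \<in> N) \<longleftrightarrow> (\<exists>s\<ge>-T. \<phi> s u \<in> N)" for T N
    by (metis minus_minus le_minus_iff)+
  moreover have "(\<forall>T. \<exists>s\<le>-T. \<phi> s u \<in> N) \<longleftrightarrow> (\<forall>T. \<exists>s\<le>T. \<phi> s u \<in> N)"
    "(\<forall>T. \<exists>s\<ge>-T. \<phi> s u \<in> N) \<longleftrightarrow> (\<forall>T. \<exists>s\<ge>T. \<phi> s u \<in> N)" for N
    by (metis minus_minus)+
  ultimately show "(\<forall>x\<in>\<Omega>. \<forall>N T. open N \<longrightarrow> x \<in> N \<longrightarrow> (\<exists>s\<ge>T. \<phi> (- s) u \<in> N)) \<or>
      (\<forall>x\<in>\<Omega>. \<forall>N T. open N \<longrightarrow> x \<in> N \<longrightarrow> (\<exists>s\<le>T. \<phi> (- s) u \<in> N))"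
    using visits by (simp add: disj_commute)
qed (use closed_Omega connected_Omega in auto)

context visited_set_with_core
begin

lemma visited_set_with_core_reverse:
  "visited_set_with_core (\<lambda>s. \<phi> (- s)) Sig (\<lambda>Q. - W Q) \<Omega> u R (- a)"
  by (rule visited_set_with_core.intro[OF visited_set_reverse], unfold_locales)
    (simp_all add: invariant_reverse equilibrium_reverse level_reverse invariant_core
      core_level equilibrium_in_core core_meets)

text \<open>Values below \<open>a\<close> are excluded directly, values above it by the same result
  for the reversed flow with the sign of \<open>W\<close> changed.\<close>

lemma level_Omega:
  assumes "x \<in> \<Omega>" "y \<in> \<Omega>" "(x, y) \<in> level k"
  shows "k = a"
proof (rule ccontr)
  assume "k \<noteq> a"
  then consider "k < a" | "- k < - a"
    by linarith
  then show False
  proof cases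
    case 1
    then show ?thesis
      using low_level_absurd assms by blast
  next
    case 2
    then show ?thesis
      using visited_set_with_core.low_level_absurd[OF visited_set_with_core_reverse, of x y "- k"] assms
      by (simp add: level_reverse)
  qed
qed

end

section \<open>Absence of crossings in the limit set\<close>

context visited_set
begin

text \<open>In the non-minimal case, the values just before and just after a crossing would both be
  the constant of the core, contrary to the strict drop.\<close>

theorem not_in_Sig:
  assumes xy: "x \<in> \<Omega>" "y \<in> \<Omega>" "x \<noteq> y"
  shows "(x, y) \<notin> Sig"
proof (cases "minimal \<Omega>")
  case True
  then show ?thesis
    using minimal_not_in_Sig xy by blast
next
  case False
  define R where "R = \<Union>{M. minimal M \<and> M \<subseteq> \<Omega>}"
  obtain a where a: "\<And>M x y. minimal M \<Longrightarrow> M \<subseteq> \<Omega> \<Longrightarrow> x \<in> \<Omega> \<Longrightarrow> y \<in> M \<Longrightarrow> x \<noteq> y \<Longrightarrow>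
      (x, y) \<in> level a"
    using W_constant_with_recurrent[OF False] by blast
  interpret core: visited_set_with_core \<phi> Sig W \<Omega> u R a
  proof unfold_locales
    show "invariant R"
      by (auto simp: R_def invariant_def minimal_def)
    show "(x, y) \<in> level a" if "x \<in> \<Omega>" "y \<in> R" "x \<noteq> y" for x y
      using that a by (auto simp: R_def)
    show "x \<in> R" if "x \<in> \<Omega>" "equilibrium x" for x
      using that minimal_equilibrium[of x] by (auto simp: R_def)
    show "C \<inter> R \<noteq> {}" if C: "closed C" "invariant C" "C \<noteq> {}" "C \<subseteq> \<Omega>" for C
    proof -
      obtain M where M: "minimal M" "M \<subseteq> C"
        by (rule minimal_exists[OF C(1-3)])
      then have "M \<subseteq> C \<inter> R"
        using C(4) by (auto simp: R_def)
      moreover have "M \<noteq> {}"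
        using M by (simp add: minimal_def)
      ultimately show ?thesis by blast
    qed
  qed
  show ?thesis
  proof
    assume Sig: "(x, y) \<in> Sig"
    have "fst (x, y) \<noteq> snd (x, y)"
      using xy by simp
    then obtain e k l N where e: "l < k" "(x, y) \<in> N"
      "\<And>Q. Q \<in> N \<Longrightarrow> \<Phi> (- e) Q \<in> level k" "\<And>Q. Q \<in> N \<Longrightarrow> \<Phi> e Q \<in> level l"
      by (rule crossing_neighbourhood[OF Sig]) blast
    have "(\<phi> (- e) x, \<phi> (- e) y) \<in> level k" "(\<phi> e x, \<phi> e y) \<in> level l"
      using e(3,4)[OF e(2)] by simp_all
    then have "k = a" "l = a"
      using core.level_Omega xy invariantD[OF invariant_Omega] by metis+
    then show False
      using e(1) by simp
  qed
qed

end

lemma visited_set_limit_set: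
  assumes "discrete_lyapunov_flow \<phi> Sig W"
  shows "visited_set \<phi> Sig W (limit_set (\<lambda>s. \<phi> s u)) u"
proof -
  interpret discrete_lyapunov_flow \<phi> Sig W
    by fact
  show ?thesis
  proof
    show "connected (limit_set (\<lambda>s. \<phi> s u))"
      by (intro connected_limit_set compact_UNIV continuous_intros)
    have "\<exists>s\<ge>T. \<phi> s u \<in> N" if x: "x \<in> limit_set (\<lambda>s. \<phi> s u)" "open N" "x \<in> N" for x N T
      using limit_setD[OF x] by blast
    then show "(\<forall>x\<in>limit_set (\<lambda>s. \<phi> s u). \<forall>N T. open N \<longrightarrow> x \<in> N \<longrightarrow> (\<exists>s\<ge>T. \<phi> s u \<in> N)) \<or>
        (\<forall>x\<in>limit_set (\<lambda>s. \<phi> s u). \<forall>N T. open N \<longrightarrow> x \<in> N \<longrightarrow> (\<exists>s\<le>T. \<phi> s u \<in> N))"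
      by blast
  qed (auto intro: closed_limit_set invariant_limit_set)
qed

section \<open>From the axioms to the induced planar flow\<close>

lemma discrete_lyapunov_flow_if_axioms:
  assumes "compact (UNIV :: 'a::t2_space set)" and flow: "continuous_flow_on UNIV (\<phi> :: real \<Rightarrow> 'a \<Rightarrow> 'a)"
    and "closed Sig" "diagonal \<subseteq> Sig" "axiom_A1 Sig W" and A5: "axiom_A5 \<phi> Sig W"
  shows "discrete_lyapunov_flow \<phi> Sig W"
proof unfold_locales
  show "continuous_on UNIV (\<lambda>p. \<phi> (fst p) (snd p))"
    using flow by (simp add: continuous_flow_on_def case_prod_unfold)
  fix Q assume Q: "Q \<in> Sig" "fst Q \<noteq> snd Q"
  then have "Q \<in> Sig - diagonal"
    by (auto simp: diagonal_def)
  then obtain e where e: "e > 0"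
    "\<forall>\<sigma>\<in>{-e<..<e} - {0}. (\<phi> \<sigma> (fst Q), \<phi> \<sigma> (snd Q)) \<notin> Sig"
    "\<forall>\<sigma>\<in>{-e<..<0}. \<forall>\<sigma>'\<in>{0<..<e}.
      W (\<phi> \<sigma> (fst Q), \<phi> \<sigma> (snd Q)) > W (\<phi> \<sigma>' (fst Q), \<phi> \<sigma>' (snd Q))"
    using A5 unfolding axiom_A5_def case_prod_unfold by blast
  have "s \<in> {-e<..<e} - {0}" if "s \<noteq> 0" "\<bar>s\<bar> < e" for s
    using that by auto
  then show "\<exists>e>0. (\<forall>s. s \<noteq> 0 \<longrightarrow> \<bar>s\<bar> < e \<longrightarrow> pair_flow \<phi> s Q \<notin> Sig) \<and>
      (\<forall>s t. - e < s \<longrightarrow> s < 0 \<longrightarrow> 0 < t \<longrightarrow> t < e \<longrightarrow>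
        W (pair_flow \<phi> t Q) < W (pair_flow \<phi> s Q))"
    using e unfolding pair_flow_def by (intro exI[of _ e]) (simp del: Diff_iff)
qed (use assms in \<open>auto simp: continuous_flow_on_def diagonal_def axiom_A1_def Compl_eq_Diff_UNIV\<close>)

lemma omega_limit_subset_limit_set: "omega_limit \<phi> u \<subseteq> limit_set (\<lambda>s. \<phi> s u)"
proof
  fix w assume "w \<in> omega_limit \<phi> u"
  then obtain s where s: "filterlim s at_top sequentially" "(\<lambda>n. \<phi> (s n) u) \<longlonglongrightarrow> w"
    by (auto simp: omega_limit_def)
  show "w \<in> limit_set (\<lambda>s. \<phi> s u)"
    unfolding limit_set_def
  proof
    fix T :: real
    have "eventually (\<lambda>n. s n \<ge> T) sequentially"
      using s(1) by (simp add: filterlim_at_top)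
    then have "eventually (\<lambda>n. \<phi> (s n) u \<in> closure ((\<lambda>s. \<phi> s u) ` {T..})) sequentially"
      by (rule eventually_mono) (auto intro!: closure_subset[THEN subsetD])
    then show "w \<in> closure ((\<lambda>s. \<phi> s u) ` {T..})"
      using s(2) by (intro Lim_in_closed_set[of _ "\<lambda>n. \<phi> (s n) u" sequentially]) auto
  qed
qed

lemma (in compact_flow) omega_limit_invariant:
  assumes "w \<in> omega_limit \<phi> u"
  shows "\<phi> \<sigma> w \<in> omega_limit \<phi> u"
proof -
  obtain s where s: "filterlim s at_top sequentially" "(\<lambda>n. \<phi> (s n) u) \<longlonglongrightarrow> w"
    using assms by (auto simp: omega_limit_def)
  have "filterlim (\<lambda>n. \<sigma> + s n) at_top sequentially"
    by (intro filterlim_tendsto_add_at_top[OF tendsto_const s(1)])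
  moreover have "continuous_on UNIV (\<phi> \<sigma>)"
    by (intro continuous_intros)
  then have "(\<lambda>n. \<phi> \<sigma> (\<phi> (s n) u)) \<longlonglongrightarrow> \<phi> \<sigma> w"
    using s(2) by (rule continuous_on_tendsto_compose) auto
  ultimately show ?thesis
    unfolding omega_limit_def by (auto simp flip: flow_add)
qed

text \<open>The flow laws transfer because \<open>g\<close> and \<open>h\<close> are mutually
  inverse; joint continuity comes from composing through \<open>UNIV \<times> S\<close>.\<close>

lemma continuous_flow_on_conjugate:
  fixes h :: "'a::topological_space \<Rightarrow> 'b::topological_space"
  assumes flow: "continuous_flow_on S \<phi>" and h: "homeomorphism S T h g"
  shows "continuous_flow_on T (\<lambda>\<sigma> x. h (\<phi> \<sigma> (g x)))"
proof -
  have g: "g x \<in> S" "h (g x) = x" if "x \<in> T" for x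
    using h that by (auto simp: homeomorphism_def)
  have gh: "g (h x) = x" "h x \<in> T" if "x \<in> S" for x
    using h that by (auto simp: homeomorphism_def)
  have \<phi>: "\<phi> \<sigma> x \<in> S" if "x \<in> S" for \<sigma> x
    using flow that by (auto simp: continuous_flow_on_def)
  have "continuous_on T g"
    using h by (auto simp: homeomorphism_def)
  then have "continuous_on (UNIV \<times> T) (\<lambda>p. g (snd p))"
    by (rule continuous_on_compose2[where f = snd]) (auto intro: continuous_on_snd)
  then have "continuous_on (UNIV \<times> T) (\<lambda>p. (fst p, g (snd p)))"
    by (intro continuous_on_Pair continuous_on_fst continuous_on_id)
  moreover have "continuous_on (UNIV \<times> S) (\<lambda>p. \<phi> (fst p) (snd p))"
    using flow by (simp add: continuous_flow_on_def case_prod_unfold)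
  moreover have "(\<lambda>p. (fst p, g (snd p))) ` (UNIV \<times> T) \<subseteq> UNIV \<times> S"
    using g by auto
  ultimately have "continuous_on (UNIV \<times> T) (\<lambda>p. \<phi> (fst p) (g (snd p)))"
    using continuous_on_compose2[of "UNIV \<times> S" "\<lambda>p. \<phi> (fst p) (snd p)" "UNIV \<times> T"
        "\<lambda>p. (fst p, g (snd p))"] by simp
  moreover have "continuous_on S h"
    using h by (auto simp: homeomorphism_def)
  moreover have "(\<lambda>p. \<phi> (fst p) (g (snd p))) ` (UNIV \<times> T) \<subseteq> S"
    using g \<phi> by auto
  ultimately have "continuous_on (UNIV \<times> T) (\<lambda>p. h (\<phi> (fst p) (g (snd p))))"
    using continuous_on_compose2[of S h "UNIV \<times> T" "\<lambda>p. \<phi> (fst p) (g (snd p))"] by simp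
  then show ?thesis
    using flow g gh \<phi> by (auto simp: continuous_flow_on_def case_prod_unfold)
qed

theorem proposition5p7:
  fixes \<phi> :: "real \<Rightarrow> 'a::t2_space \<Rightarrow> 'a"
    and Sig :: "('a \<times> 'a) set"
    and W :: "'a \<times> 'a \<Rightarrow> int"
    and \<pi> :: "'a \<Rightarrow> real ^ 2"
    and u :: 'a
  assumes "compact (UNIV :: 'a set)"
    and "continuous_flow_on UNIV \<phi>"
    and "closed Sig"
    and "diagonal \<subseteq> Sig"
    and "axiom_A1 Sig W"
    and "axiom_A2 \<pi>"
    and "axiom_A3 Sig \<pi>"
    and "axiom_A4 \<phi> Sig"
    and "axiom_A5 \<phi> Sig W"
  shows "homeomorphism (omega_limit \<phi> u) (\<pi> ` omega_limit \<phi> u) \<pi> (inv_into (omega_limit \<phi> u) \<pi>)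
    \<and> continuous_flow_on (\<pi> ` omega_limit \<phi> u)
         (\<lambda>\<sigma> x. \<pi> (\<phi> \<sigma> (inv_into (omega_limit \<phi> u) \<pi> x)))"
proof
  interpret discrete_lyapunov_flow \<phi> Sig W
    using assms by (intro discrete_lyapunov_flow_if_axioms)
  interpret visited_set \<phi> Sig W "limit_set (\<lambda>s. \<phi> s u)" u
    by (rule visited_set_limit_set) unfold_locales
  let ?L = "limit_set (\<lambda>s. \<phi> s u)" and ?S = "omega_limit \<phi> u"
  have \<pi>: "continuous_on C \<pi>" for C
    using assms(6) continuous_on_subset by (auto simp: axiom_A2_def)
  have inj: "inj_on \<pi> ?L"
  proof (rule inj_onI, rule ccontr)
    fix x y assume xy: "x \<in> ?L" "y \<in> ?L" "\<pi> x = \<pi> y" "x \<noteq> y"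
    then have "(x, y) \<in> Sig"
      using assms(7) by (auto simp: axiom_A3_def)
    then show False
      using not_in_Sig xy by blast
  qed
  have sub: "?S \<subseteq> ?L"
    by (rule omega_limit_subset_limit_set)
  \<comment> \<open>On the image of \<open>?S\<close> both inverses agree; the one on the compact
    set \<open>?L\<close> is continuous, and its continuity is restricted.\<close>
  have inv: "inv_into ?S \<pi> (\<pi> x) = inv_into ?L \<pi> (\<pi> x)" if "x \<in> ?S" for x
    using inj sub that by (metis inj_on_subset inv_into_f_f subsetD)
  have "continuous_on (\<pi> ` ?L) (inv_into ?L \<pi>)"
    by (rule continuous_on_inv[OF \<pi> closed_compact[OF closed_limit_set]]) (simp add: inj)
  then have "continuous_on (\<pi> ` ?S) (inv_into ?L \<pi>)"
    by (rule continuous_on_subset) (use sub in auto)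
  then have "continuous_on (\<pi> ` ?S) (inv_into ?S \<pi>)"
    by (rule continuous_on_eq) (use inv in auto)
  then show homeo: "homeomorphism ?S (\<pi> ` ?S) \<pi> (inv_into ?S \<pi>)"
    using \<pi> inj_on_subset[OF inj sub]
    by (intro homeomorphismI) (auto simp: inv_into_into f_inv_into_f)
  have "continuous_flow_on ?S \<phi>"
    using assms(2) omega_limit_invariant
    by (auto simp: continuous_flow_on_def intro: continuous_on_subset)
  then show "continuous_flow_on (\<pi> ` ?S) (\<lambda>\<sigma> x. \<pi> (\<phi> \<sigma> (inv_into ?S \<pi> x)))"
    using homeo by (rule continuous_flow_on_conjugate)
qed

end
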